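(* Let $G=\{g_1=e,g_2,\ldots,g_n\}$ be a finite group of order $n$ with a fixed enumeration, and let $\mathfrak{A}$ be an algebra over $\mathbb{C}$ with identity $I$. Let $\Phi_1,\ldots,\Phi_s$ be a complete set of pairwise inequivalent irreducible unitary representations of $G$, of degrees $n_1,\ldots,n_s$, and let $\varphi_k(g)=\bigl(\varphi^k_{ij}(g)\bigr)_{i,j=1}^{n_k}$ be the matrix of $\Phi_k(g)$ with respect to a fixed orthonormal basis of the representation space of $\Phi_k$. Let $\mathcal{F}$ be the unitary $n\times n$ complex matrix built from these representations as described in the context. Then for every family $(a(g))_{g\in G}$ of elements of $\mathfrak{A}$, the matrix $A=\bigl(a(g_ig_j^{-1})\bigr)_{i,j=1}^n\in\mathfrak{A}\bigotimes\mathbb{C}[G]$ admits the factorization $$A=\mathcal{F}^{*}\Lambda\mathcal{F},$$ where $\Lambda=\mathrm{diag}[\Lambda_1,\ldots,\Lambda_s]$ is block diagonal, each $\Lambda_k$ is the $n_k^2\times n_k^2$ block diagonal matrix $$\Lambda_k=\mathrm{diag}\bigl[\underbrace{\lambda_k,\ldots,\lambda_k}_{n_k}\bigr],$$ and $\lambda_k=\sum_{g\in G}a(g)\varphi_k(g)$ is an $n_k\times n_k$ matrix with entries in $\mathfrak{A}$, $k=1,\ldots,s$.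
   Context: $\mathfrak{A}\bigotimes\mathbb{C}[G]$ denotes the algebra of $n\times n$ matrices over $\mathfrak{A}$ of the form $\bigl(a(g_ig_j^{-1})\bigr)_{i,j=1}^n$ with $a(g)\in\mathfrak{A}$ for $g\in G$. Complex matrices are regarded as matrices over $\mathfrak{A}$ via $c\mapsto cI$. Here $s$ is the number of conjugacy classes of $G$, and $n_1^2+\cdots+n_s^2=n$. For each $k$ and $g\in G$ let $$f_k(g)=\sqrt{n_k}\,\mathrm{col}\bigl(\varphi_{11}^k(g),\ldots,\varphi_{n_k1}^k(g);\ldots;\varphi_{1n_k}^k(g),\ldots,\varphi_{n_kn_k}^k(g)\bigr)\in\mathbb{C}^{n_k^2}$$ be the column obtained by stacking the columns of the matrix $\sqrt{n_k}\,\varphi_k(g)$ one under another. Let $\mathcal{F}_k=\bigl(f_k(g_1)\ \cdots\ f_k(g_n)\bigr)$, an $n_k^2\times n$ matrix, and let $$\mathcal{F}=\frac{1}{\sqrt{n}}\begin{pmatrix}\mathcal{F}_1\\ \vdots\\ \mathcal{F}_s\end{pmatrix},$$ an $n\times n$ matrix. By Schur's orthogonality relations $\mathcal{F}$ is unitary; $\mathcal{F}^*$ is its conjugate transpose. *)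

theory Defs
  imports
    "HOL-Algebra.Coset"
    "Jordan_Normal_Form.Schur_Decomposition"
    "Jordan_Normal_Form.VS_Connect"
begin

section \<open>Unital algebras over the complex numbers\<close>

text \<open>
  The sort \<open>{ring, monoid_mult}\<close> is an arbitrary (not necessarily commutative) ring with
  identity; unlike \<open>ring_1\<close> it does not exclude the zero ring.
\<close>

locale complex_algebra = vector_space scale
  for scale :: "complex \<Rightarrow> 'a::{ring, monoid_mult} \<Rightarrow> 'a" +
  assumes scale_mult_left: "scale c x * y = scale c (x * y)"
    and scale_mult_right: "x * scale c y = scale c (x * y)"

definition embed_mat ::
    "(complex \<Rightarrow> 'a::{ring, monoid_mult} \<Rightarrow> 'a) \<Rightarrow> complex mat \<Rightarrow> 'a mat" where
  "embed_mat scale M = map_mat (\<lambda>c. scale c 1) M"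

section \<open>Unitary representations\<close>

definition unitary_mat :: "nat \<Rightarrow> complex mat \<Rightarrow> bool" where
  "unitary_mat d U \<longleftrightarrow> U \<in> carrier_mat d d \<and>
     inverts_mat U (mat_adjoint U) \<and> inverts_mat (mat_adjoint U) U"

text \<open>The group \<open>U(d)\<close> is the multiplicative part of this record.\<close>

definition unitary_group :: "nat \<Rightarrow> complex mat ring" where
  "unitary_group d = ring_mat TYPE(complex) d () \<lparr>carrier := {U. unitary_mat d U}\<rparr>"

text \<open>
  The representation space of a unitary representation of degree \<open>d\<close> is the space
  \<open>carrier_vec d\<close> of complex vectors with its standard inner product \<open>v \<bullet>c w\<close>
  (conjugate-linear in \<open>w\<close>); the operator belonging to \<open>x\<close> is \<open>v \<mapsto> \<Phi> x *\<^sub>v v\<close>.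
\<close>

definition unitary_rep :: "('g, 'm) monoid_scheme \<Rightarrow> nat \<Rightarrow> ('g \<Rightarrow> complex mat) \<Rightarrow> bool" where
  "unitary_rep G d \<Phi> \<longleftrightarrow> \<Phi> \<in> hom G (unitary_group d)"

definition irreducible_rep :: "('g, 'm) monoid_scheme \<Rightarrow> nat \<Rightarrow> ('g \<Rightarrow> complex mat) \<Rightarrow> bool" where
  "irreducible_rep G d \<Phi> \<longleftrightarrow> d > 0 \<and>
     (\<forall>W. VectorSpace.subspace class_ring W (module_vec TYPE(complex) d) \<and>
          (\<forall>x\<in>carrier G. \<forall>v\<in>W. \<Phi> x *\<^sub>v v \<in> W)
        \<longrightarrow> W = {0\<^sub>v d} \<or> W = carrier_vec d)"

definition equivalent_rep ::
    "('g, 'm) monoid_scheme \<Rightarrow> nat \<Rightarrow> ('g \<Rightarrow> complex mat) \<Rightarrow> nat \<Rightarrow> ('g \<Rightarrow> complex mat) \<Rightarrow> bool" where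
  "equivalent_rep G d \<Phi> d' \<Psi> \<longleftrightarrow>
     (\<exists>T\<in>carrier_mat d' d. invertible_mat T \<and> (\<forall>x\<in>carrier G. T * \<Phi> x = \<Psi> x * T))"

definition complete_irreps ::
    "('g, 'm) monoid_scheme \<Rightarrow> nat \<Rightarrow> (nat \<Rightarrow> nat) \<Rightarrow> (nat \<Rightarrow> 'g \<Rightarrow> complex mat) \<Rightarrow> bool" where
  "complete_irreps G s d \<Phi> \<longleftrightarrow>
     (\<forall>k<s. unitary_rep G (d k) (\<Phi> k) \<and> irreducible_rep G (d k) (\<Phi> k)) \<and>
     (\<forall>k<s. \<forall>l<s. k \<noteq> l \<longrightarrow> \<not> equivalent_rep G (d k) (\<Phi> k) (d l) (\<Phi> l)) \<and>
     (\<forall>m \<Psi>. unitary_rep G m \<Psi> \<and> irreducible_rep G m \<Psi>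
        \<longrightarrow> (\<exists>k<s. equivalent_rep G m \<Psi> (d k) (\<Phi> k)))"

text \<open>\<open>d\<close> orthonormal vectors of \<open>carrier_vec d\<close> automatically span it.\<close>

definition orthonormal_basis :: "nat \<Rightarrow> (nat \<Rightarrow> complex vec) \<Rightarrow> bool" where
  "orthonormal_basis d b \<longleftrightarrow>
     (\<forall>i<d. b i \<in> carrier_vec d) \<and> (\<forall>i<d. \<forall>j<d. b i \<bullet>c b j = (if i = j then 1 else 0))"

definition basis_mat :: "nat \<Rightarrow> (nat \<Rightarrow> complex vec) \<Rightarrow> complex mat \<Rightarrow> complex mat" where
  "basis_mat d b M = mat d d (\<lambda>(i, j). (M *\<^sub>v b j) \<bullet>c b i)"

section \<open>The matrices of the factorization\<close>

text \<open>
  Indices start at 0: \<open>g\<close> enumerates the group on \<open>{..<n}\<close>, the representations are numbered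
  by \<open>k < s\<close>, and \<open>\<phi> k x\<close> is the matrix of size \<open>d k\<close> of the \<open>k\<close>-th one at \<open>x\<close>.
\<close>

definition group_mat ::
    "('g, 'm) monoid_scheme \<Rightarrow> nat \<Rightarrow> (nat \<Rightarrow> 'g) \<Rightarrow> ('g \<Rightarrow> 'a) \<Rightarrow> 'a mat" where
  "group_mat G n g a = mat n n (\<lambda>(i, j). a (g i \<otimes>\<^bsub>G\<^esub> inv\<^bsub>G\<^esub> g j))"

text \<open>Entry \<open>p = j * d + i\<close> with \<open>i < d\<close> of the stacked columns is the \<open>(i, j)\<close> entry.\<close>

definition stack_cols :: "nat \<Rightarrow> complex mat \<Rightarrow> complex vec" where
  "stack_cols d M = vec (d\<^sup>2) (\<lambda>p. M $$ (p mod d, p div d))"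

definition fourier_col :: "nat \<Rightarrow> ('g \<Rightarrow> complex mat) \<Rightarrow> 'g \<Rightarrow> complex vec" where
  "fourier_col d \<phi> x = stack_cols d (complex_of_real (sqrt (real d)) \<cdot>\<^sub>m \<phi> x)"

definition fourier_block ::
    "nat \<Rightarrow> (nat \<Rightarrow> 'g) \<Rightarrow> nat \<Rightarrow> ('g \<Rightarrow> complex mat) \<Rightarrow> complex mat" where
  "fourier_block n g d \<phi> = mat_of_cols (d\<^sup>2) (map (\<lambda>i. fourier_col d \<phi> (g i)) [0..<n])"

definition fourier_mat ::
    "nat \<Rightarrow> (nat \<Rightarrow> 'g) \<Rightarrow> nat \<Rightarrow> (nat \<Rightarrow> nat) \<Rightarrow> (nat \<Rightarrow> 'g \<Rightarrow> complex mat) \<Rightarrow> complex mat" where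
  "fourier_mat n g s d \<phi> =
     complex_of_real (1 / sqrt (real n)) \<cdot>\<^sub>m
       mat_of_rows n (concat (map (\<lambda>k. rows (fourier_block n g (d k) (\<phi> k))) [0..<s]))"

definition lambda_mat ::
    "(complex \<Rightarrow> 'a::{ring, monoid_mult} \<Rightarrow> 'a) \<Rightarrow> ('g, 'm) monoid_scheme \<Rightarrow>
     ('g \<Rightarrow> 'a) \<Rightarrow> nat \<Rightarrow> ('g \<Rightarrow> complex mat) \<Rightarrow> 'a mat" where
  "lambda_mat scale G a d \<phi> =
     mat d d (\<lambda>(i, j). \<Sum>x\<in>carrier G. a x * embed_mat scale (\<phi> x) $$ (i, j))"

definition Lambda_block ::
    "(complex \<Rightarrow> 'a::{ring, monoid_mult} \<Rightarrow> 'a) \<Rightarrow> ('g, 'm) monoid_scheme \<Rightarrow>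
     ('g \<Rightarrow> 'a) \<Rightarrow> nat \<Rightarrow> ('g \<Rightarrow> complex mat) \<Rightarrow> 'a mat" where
  "Lambda_block scale G a d \<phi> = diag_block_mat (replicate d (lambda_mat scale G a d \<phi>))"

definition Lambda_mat ::
    "(complex \<Rightarrow> 'a::{ring, monoid_mult} \<Rightarrow> 'a) \<Rightarrow> ('g, 'm) monoid_scheme \<Rightarrow>
     ('g \<Rightarrow> 'a) \<Rightarrow> nat \<Rightarrow> (nat \<Rightarrow> nat) \<Rightarrow> (nat \<Rightarrow> 'g \<Rightarrow> complex mat) \<Rightarrow> 'a mat" where
  "Lambda_mat scale G a s d \<phi> =
     diag_block_mat (map (\<lambda>k. Lambda_block scale G a (d k) (\<phi> k)) [0..<s])"

end

theory Submission
  imports Defs "Jordan_Normal_Form.Spectral_Radius"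
begin

text \<open>
  Orthonormality of the rows of \<open>\<F>\<close> is Schur orthogonality. For the columns it suffices that
  \<open>\<F>\<close> is injective, since \<open>\<F> (\<F>\<^sup>* \<F>) = \<F>\<close>; comparing the traces of \<open>\<F> \<F>\<^sup>*\<close> and \<open>\<F>\<^sup>* \<F>\<close> then
  shows that \<open>\<F>\<close> is square. Injectivity says that a function \<open>f\<close> on \<open>G\<close> with
  \<open>\<Sum>\<^sub>x f(x) \<phi>\<^sub>k(x) = 0\<close> for all \<open>k\<close> vanishes: by complete reducibility \<open>\<Sum>\<^sub>x f(x) \<Psi>(x) = 0\<close> for every
  unitary representation \<open>\<Psi>\<close>, and for the regular one this sum has the values of \<open>f\<close> as entries.

  For the factorization, multiplication by \<open>\<phi>\<^sub>k(x)\<close> takes the stacked columns of \<open>\<phi>\<^sub>k(g\<^sub>j)\<close> to those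
  of \<open>\<phi>\<^sub>k(x g\<^sub>j)\<close>, so column \<open>j\<close> of \<open>\<Lambda> \<F>\<close> is the sum over \<open>x\<close> of \<open>a(x)\<close> times the column of \<open>\<F>\<close>
  belonging to \<open>x g\<^sub>j\<close>, and orthonormality of the columns picks out \<open>x = g\<^sub>i g\<^sub>j\<^sup>-\<^sup>1\<close>.
\<close>

section \<open>Adjoints and isometries\<close>

lemma dim_mat_adjoint [simp]:
  "dim_row (mat_adjoint A) = dim_col A" "dim_col (mat_adjoint A) = dim_row A"
  by (simp_all add: mat_adjoint_def)

lemma mat_adjoint_carrier [simp, intro]:
  "A \<in> carrier_mat m n \<Longrightarrow> mat_adjoint A \<in> carrier_mat n m"
  by (rule carrier_matI) auto

lemma index_mat_adjoint [simp]:
  "i < dim_col A \<Longrightarrow> j < dim_row A \<Longrightarrow> mat_adjoint A $$ (i, j) = conjugate (A $$ (j, i))"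
  by (simp add: mat_adjoint_def mat_of_rows_def)

lemma mat_adjoint_mat_adjoint [simp]: "mat_adjoint (mat_adjoint A) = A"
  by (rule eq_matI) auto

lemma index_mult_mat_sum:
  assumes "A \<in> carrier_mat m n" "B \<in> carrier_mat n p" "i < m" "j < p"
  shows "(A * B) $$ (i, j) = (\<Sum>k<n. A $$ (i, k) * B $$ (k, j))"
  using assms by (auto simp: scalar_prod_def atLeast0LessThan intro!: sum.cong)

lemma mat_adjoint_mult:
  fixes A :: "complex mat"
  assumes A: "A \<in> carrier_mat m n" and B: "B \<in> carrier_mat n p"
  shows "mat_adjoint (A * B) = mat_adjoint B * mat_adjoint A"
proof (rule eq_matI)
  fix i j assume "i < dim_row (mat_adjoint B * mat_adjoint A)" "j < dim_col (mat_adjoint B * mat_adjoint A)"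
  then have ij: "i < p" "j < m" using A B by auto
  then have "mat_adjoint (A * B) $$ (i, j) = cnj ((A * B) $$ (j, i))"
    using A B by simp
  also have "\<dots> = (mat_adjoint B * mat_adjoint A) $$ (i, j)"
    unfolding index_mult_mat_sum[OF A B ij(2,1)]
      index_mult_mat_sum[OF mat_adjoint_carrier[OF B] mat_adjoint_carrier[OF A] ij]
    using A B ij by (auto simp: mult.commute intro!: sum.cong)
  finally show "mat_adjoint (A * B) $$ (i, j) = (mat_adjoint B * mat_adjoint A) $$ (i, j)" .
qed (use A B in auto)

text \<open>Cyclicity of the trace for rectangular factors. It serves to compare dimensions, since
  the trace of an identity matrix is its size.\<close>

lemma sum_diag_mult_comm:
  fixes A :: "'a::comm_semiring_0 mat"
  assumes A: "A \<in> carrier_mat m n" and B: "B \<in> carrier_mat n m"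
  shows "(\<Sum>i<m. (A * B) $$ (i, i)) = (\<Sum>j<n. (B * A) $$ (j, j))"
proof -
  have "(\<Sum>i<m. (A * B) $$ (i, i)) = (\<Sum>i<m. \<Sum>j<n. A $$ (i, j) * B $$ (j, i))"
    by (rule sum.cong) (auto simp: index_mult_mat_sum[OF A B])
  also have "\<dots> = (\<Sum>j<n. \<Sum>i<m. B $$ (j, i) * A $$ (i, j))"
    by (subst sum.swap) (simp add: mult.commute)
  also have "\<dots> = (\<Sum>j<n. (B * A) $$ (j, j))"
    by (rule sum.cong) (auto simp: index_mult_mat_sum[OF B A])
  finally show ?thesis .
qed

text \<open>The two products are identities of sizes \<open>m\<close> and \<open>n\<close> with
  equal traces, and characteristic zero allows reading off the sizes.\<close>

lemma two_sided_inverse_imp_square: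
  fixes A :: "complex mat"
  assumes A: "A \<in> carrier_mat m n" and B: "B \<in> carrier_mat n m"
    and "A * B = 1\<^sub>m m" "B * A = 1\<^sub>m n"
  shows "m = n"
  using sum_diag_mult_comm[OF A B] assms(3,4) by simp

text \<open>A diagonal entry of the product is the sum of the squared moduli of a column of
  \<open>A\<close>.\<close>

lemma mat_adjoint_mult_self_eq_0:
  fixes A :: "complex mat"
  assumes A: "A \<in> carrier_mat m n" and z: "mat_adjoint A * A = 0\<^sub>m n n"
  shows "A = 0\<^sub>m m n"
proof (rule eq_matI)
  fix i j assume "i < dim_row (0\<^sub>m m n :: complex mat)" "j < dim_col (0\<^sub>m m n :: complex mat)"
  then have ij: "i < m" "j < n" by auto
  have "0 = (mat_adjoint A * A) $$ (j, j)" using z ij by simp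
  also have "\<dots> = (\<Sum>k<m. cnj (A $$ (k, j)) * A $$ (k, j))"
    unfolding index_mult_mat_sum[OF mat_adjoint_carrier[OF A] A ij(2,2)] using A ij by auto
  also have "\<dots> = of_real (\<Sum>k<m. (cmod (A $$ (k, j)))\<^sup>2)"
    unfolding of_real_sum
    by (intro sum.cong) (simp_all only: complex_norm_square mult.commute)
  finally have "(\<Sum>k<m. (cmod (A $$ (k, j)))\<^sup>2) = 0"
    by (metis of_real_eq_0_iff)
  then show "A $$ (i, j) = 0\<^sub>m m n $$ (i, j)"
    using ij by (auto simp: sum_nonneg_eq_0_iff)
qed (use A in auto)

text \<open>Bounds the size of an orthonormal system, so that \<open>subspace_isometry\<close> can
  choose one of largest size.\<close>

lemma isometry_imp_le:
  fixes P :: "complex mat"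
  assumes P: "P \<in> carrier_mat m r" and iso: "mat_adjoint P * P = 1\<^sub>m r"
  shows "r \<le> m"
proof (rule ccontr)
  assume "\<not> r \<le> m"
  then have rm: "m < r" by simp
  \<comment> \<open>Padding by zero rows gives a square matrix with a left inverse but a zero row.\<close>
  define Q where "Q = mat r r (\<lambda>(i, j). if i < m then P $$ (i, j) else 0)"
  have Q: "Q \<in> carrier_mat r r" by (simp add: Q_def)
  have "mat_adjoint Q * Q = 1\<^sub>m r"
  proof (rule eq_matI)
    fix i j assume "i < dim_row (1\<^sub>m r :: complex mat)" "j < dim_col (1\<^sub>m r :: complex mat)"
    then have ij: "i < r" "j < r" by auto
    have "(mat_adjoint Q * Q) $$ (i, j) = (\<Sum>k<r. cnj (Q $$ (k, i)) * Q $$ (k, j))"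
      unfolding index_mult_mat_sum[OF mat_adjoint_carrier[OF Q] Q ij] using Q ij by auto
    also have "\<dots> = (\<Sum>k<m. cnj (P $$ (k, i)) * P $$ (k, j))"
      using rm ij by (intro sum.mono_neutral_cong_right) (auto simp: Q_def)
    also have "\<dots> = (mat_adjoint P * P) $$ (i, j)"
      unfolding index_mult_mat_sum[OF mat_adjoint_carrier[OF P] P ij] using P ij by auto
    finally show "(mat_adjoint Q * Q) $$ (i, j) = 1\<^sub>m r $$ (i, j)" by (simp only: iso)
  qed (use Q in auto)
  then have "Q * mat_adjoint Q = 1\<^sub>m r"
    using mat_mult_left_right_inverse[OF mat_adjoint_carrier[OF Q] Q] by simp
  then have "(Q * mat_adjoint Q) $$ (m, m) = 1" using rm by simp
  moreover have "(Q * mat_adjoint Q) $$ (m, m) = 0"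
    unfolding index_mult_mat_sum[OF Q mat_adjoint_carrier[OF Q] rm rm]
    using rm by (auto simp: Q_def intro!: sum.neutral)
  ultimately show False by simp
qed

section \<open>Orthonormal bases of subspaces\<close>

abbreviation is_subspace :: "nat \<Rightarrow> complex vec set \<Rightarrow> bool" where
  "is_subspace m W \<equiv> VectorSpace.subspace class_ring W (module_vec TYPE(complex) m)"

lemma is_subspace_iff:
  "is_subspace m W \<longleftrightarrow> W \<subseteq> carrier_vec m \<and> 0\<^sub>v m \<in> W \<and>
     (\<forall>v\<in>W. \<forall>w\<in>W. v + w \<in> W) \<and> (\<forall>c. \<forall>v\<in>W. c \<cdot>\<^sub>v v \<in> W)"
proof -
  have "vectorspace (class_ring :: complex ring) (module_vec TYPE(complex) m)" by (rule vec_vs)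
  moreover have "Module.module (class_ring :: complex ring) (module_vec TYPE(complex) m)"
    by (rule vec_module)
  ultimately show ?thesis
    unfolding VectorSpace.subspace_def submodule_def by (simp add: module_vec_simps) blast
qed

lemma is_subspace_kernel:
  assumes A: "A \<in> carrier_mat r m"
  shows "is_subspace m {v \<in> carrier_vec m. A *\<^sub>v v = 0\<^sub>v r}"
  using A by (auto simp: is_subspace_iff mult_add_distrib_mat_vec[OF A] mult_mat_vec[OF A])

text \<open>The columns of \<open>P\<close> are an orthonormal basis of \<open>W\<close>, found as
  an orthonormal system in \<open>W\<close> of maximal size. If the projection
  \<open>P *\<^sub>v (mat_adjoint P *\<^sub>v w)\<close> differed from some \<open>w\<close>, the
  normalised difference would extend the system.\<close>

lemma subspace_isometry:
  assumes W: "is_subspace m W"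
  obtains r P where "P \<in> carrier_mat m r" "mat_adjoint P * P = 1\<^sub>m r"
    "\<forall>v\<in>carrier_vec r. P *\<^sub>v v \<in> W"
    "\<forall>w\<in>W. P *\<^sub>v (mat_adjoint P *\<^sub>v w) = w"
proof -
  note W' = W[unfolded is_subspace_iff]
  define ok where "ok r \<longleftrightarrow> (\<exists>P\<in>carrier_mat m r. mat_adjoint P * P = 1\<^sub>m r \<and>
    (\<forall>v\<in>carrier_vec r. P *\<^sub>v v \<in> W))" for r
  have ok0: "ok 0"
  proof -
    have "0\<^sub>m m 0 *\<^sub>v v = (0\<^sub>v m :: complex vec)" if "v \<in> carrier_vec 0" for v
      using that by (intro eq_vecI) (auto simp: scalar_prod_def)
    then have "\<forall>v\<in>carrier_vec 0. 0\<^sub>m m 0 *\<^sub>v v \<in> W" using W' by auto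
    moreover have "mat_adjoint (0\<^sub>m m 0) * 0\<^sub>m m 0 = (1\<^sub>m 0 :: complex mat)"
      by (rule eq_matI) auto
    ultimately show ?thesis unfolding ok_def by (intro bexI[of _ "0\<^sub>m m 0"]) auto
  qed
  have bound: "r \<le> m" if "ok r" for r
    using that isometry_imp_le unfolding ok_def by blast
  \<comment> \<open>The matrix without columns gives \<open>ok 0\<close> and \<open>bound\<close>
    caps the sizes, so a greatest one exists.\<close>
  define r where "r = (GREATEST r. ok r)"
  have "ok r" unfolding r_def using GreatestI_nat[of ok 0 m] ok0 bound by auto
  have max: "\<not> ok (Suc r)"
    using Greatest_le_nat[of ok "Suc r" m] bound unfolding r_def by auto
  from \<open>ok r\<close> obtain P where P: "P \<in> carrier_mat m r" and iso: "mat_adjoint P * P = 1\<^sub>m r"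
    and PW: "\<And>v. v \<in> carrier_vec r \<Longrightarrow> P *\<^sub>v v \<in> W" unfolding ok_def by auto
  note Pa = mat_adjoint_carrier[OF P]
  have "P *\<^sub>v (mat_adjoint P *\<^sub>v w) = w" if w: "w \<in> W" for w
  proof (rule ccontr)
    assume neq: "P *\<^sub>v (mat_adjoint P *\<^sub>v w) \<noteq> w"
    have wc: "w \<in> carrier_vec m" using w W' by auto
    define p where "p = P *\<^sub>v (mat_adjoint P *\<^sub>v w)"
    have aw: "mat_adjoint P *\<^sub>v w \<in> carrier_vec r" using Pa wc by auto
    have pW: "p \<in> W" unfolding p_def by (rule PW[OF aw])
    have pc: "p \<in> carrier_vec m" using pW W' by auto
    \<comment> \<open>The component of \<open>w\<close> orthogonal to the columns of
      \<open>P\<close>; it stays in \<open>W\<close> and is nonzero by \<open>neq\<close>.\<close>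
    define u where "u = w + (-1) \<cdot>\<^sub>v p"
    have uW: "u \<in> W" unfolding u_def using w pW W' by auto
    have uc: "u \<in> carrier_vec m" using uW W' by auto
    have u0: "u \<noteq> 0\<^sub>v m"
    proof
      assume u0: "u = 0\<^sub>v m"
      have "p = w"
      proof (rule eq_vecI)
        fix i assume "i < dim_vec w"
        then have "u $ i = w $ i - p $ i" "i < m" using wc pc by (auto simp: u_def)
        then show "p $ i = w $ i" using u0 by simp
      qed (use wc pc in auto)
      with neq show False by (simp add: p_def)
    qed
    have Pp: "mat_adjoint P *\<^sub>v p = mat_adjoint P *\<^sub>v w"
      unfolding p_def using assoc_mult_mat_vec[OF Pa P aw] iso aw by simp
    have cancel: "z + (-1) \<cdot>\<^sub>v z = 0\<^sub>v r" if "z \<in> carrier_vec r" for z :: "complex vec"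
      using that by (intro eq_vecI) auto
    have Pu: "mat_adjoint P *\<^sub>v u = 0\<^sub>v r"
    proof -
      have "mat_adjoint P *\<^sub>v u = mat_adjoint P *\<^sub>v w + (-1) \<cdot>\<^sub>v (mat_adjoint P *\<^sub>v p)"
        unfolding u_def using mult_add_distrib_mat_vec[OF Pa wc, of "(-1) \<cdot>\<^sub>v p"] pc
          mult_mat_vec[OF Pa pc] by auto
      also have "\<dots> = 0\<^sub>v r" unfolding Pp using cancel[OF aw] .
      finally show ?thesis .
    qed
    define N where "N = (\<Sum>k<m. (cmod (u $ k))\<^sup>2)"
    have N: "N > 0"
    proof -
      obtain k where k: "k < m" "u $ k \<noteq> 0" using u0 uc by (metis carrier_vecD eq_vecI index_zero_vec)
      then have "0 < (cmod (u $ k))\<^sup>2" by simp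
      also have "\<dots> \<le> N" unfolding N_def using k by (intro member_le_sum) auto
      finally show ?thesis .
    qed
    \<comment> \<open>Since \<open>N\<close> is the squared norm of \<open>u\<close>, this is a unit
      vector. It becomes the extra column of \<open>P'\<close>.\<close>
    define e where "e = complex_of_real (1 / sqrt N) \<cdot>\<^sub>v u"
    have ec: "e \<in> carrier_vec m" using uc by (simp add: e_def)
    have eW: "e \<in> W" unfolding e_def using uW W' by auto
    have Pe: "(\<Sum>k<m. cnj (P $$ (k, i)) * e $ k) = 0" if i: "i < r" for i
    proof -
      have "0 = (mat_adjoint P *\<^sub>v u) $ i" using Pu i by simp
      also have "\<dots> = (\<Sum>k<m. cnj (P $$ (k, i)) * u $ k)"
        using P uc i by (auto simp: scalar_prod_def atLeast0LessThan intro!: sum.cong)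
      finally have *: "(\<Sum>k<m. cnj (P $$ (k, i)) * u $ k) = 0" by simp
      have "(\<Sum>k<m. cnj (P $$ (k, i)) * e $ k) = complex_of_real (1 / sqrt N) * (\<Sum>k<m. cnj (P $$ (k, i)) * u $ k)"
        unfolding e_def sum_distrib_left using uc by (intro sum.cong) (auto simp: mult_ac)
      then show ?thesis using * by simp
    qed
    have ee: "(\<Sum>k<m. cnj (e $ k) * e $ k) = 1"
    proof -
      have "(\<Sum>k<m. cnj (e $ k) * e $ k) = (\<Sum>k<m. complex_of_real (1 / N * (cmod (u $ k))\<^sup>2))"
      proof (rule sum.cong)
        fix k assume "k \<in> {..<m}"
        then have k: "k < m" by simp
        have "cnj (e $ k) * e $ k = complex_of_real (1 / sqrt N) * complex_of_real (1 / sqrt N) * (u $ k * cnj (u $ k))"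
          unfolding e_def using k uc by (simp add: mult_ac)
        also have "\<dots> = complex_of_real (1 / sqrt N * (1 / sqrt N) * (cmod (u $ k))\<^sup>2)"
          by (simp only: complex_norm_square[symmetric] of_real_mult)
        also have "1 / sqrt N * (1 / sqrt N) = 1 / N" using N by (simp add: field_simps)
        finally show "cnj (e $ k) * e $ k = complex_of_real (1 / N * (cmod (u $ k))\<^sup>2)" .
      qed simp
      also have "\<dots> = complex_of_real (1 / N * N)"
        unfolding N_def sum_distrib_left of_real_sum ..
      finally show ?thesis using N by simp
    qed
    define P' where "P' = mat m (Suc r) (\<lambda>(i, j). if j < r then P $$ (i, j) else e $ i)"
    have P': "P' \<in> carrier_mat m (Suc r)" by (simp add: P'_def)
    have "mat_adjoint P' * P' = 1\<^sub>m (Suc r)"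
    proof (rule eq_matI)
      fix i j assume "i < dim_row (1\<^sub>m (Suc r) :: complex mat)" "j < dim_col (1\<^sub>m (Suc r) :: complex mat)"
      then have ij: "i < Suc r" "j < Suc r" by auto
      have eq: "(mat_adjoint P' * P') $$ (i, j) = (\<Sum>k<m. cnj (P' $$ (k, i)) * P' $$ (k, j))"
        unfolding index_mult_mat_sum[OF mat_adjoint_carrier[OF P'] P' ij] using P' ij by auto
      have PP: "(\<Sum>k<m. cnj (P $$ (k, i)) * P $$ (k, j)) = (if i = j then 1 else 0)" if "i < r" "j < r"
      proof -
        have "(if i = j then 1 else 0) = (mat_adjoint P * P) $$ (i, j)" using iso that by simp
        also have "\<dots> = (\<Sum>k<m. cnj (P $$ (k, i)) * P $$ (k, j))"
          unfolding index_mult_mat_sum[OF Pa P that] using P that by auto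
        finally show ?thesis by simp
      qed
      have eP: "(\<Sum>k<m. cnj (e $ k) * P $$ (k, j)) = 0" if "j < r"
        using arg_cong[OF Pe[OF that], of cnj] by (simp add: mult.commute)
      consider "i < r" "j < r" | "i < r" "j = r" | "i = r" "j < r" | "i = r" "j = r"
        using ij by linarith
      then show "(mat_adjoint P' * P') $$ (i, j) = 1\<^sub>m (Suc r) $$ (i, j)"
        unfolding eq by cases (auto simp: P'_def PP Pe eP ee)
    qed (use P' in auto)
    moreover have "P' *\<^sub>v v \<in> W" if v: "v \<in> carrier_vec (Suc r)" for v
    proof -
      have "P' *\<^sub>v v = P *\<^sub>v vec r (\<lambda>i. v $ i) + (v $ r) \<cdot>\<^sub>v e"
      proof (rule eq_vecI)
        fix i assume "i < dim_vec (P *\<^sub>v vec r (\<lambda>i. v $ i) + (v $ r) \<cdot>\<^sub>v e)"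
        then have i: "i < m" using ec by simp
        then show "(P' *\<^sub>v v) $ i = (P *\<^sub>v vec r (\<lambda>i. v $ i) + (v $ r) \<cdot>\<^sub>v e) $ i"
          using v P ec by (auto simp: P'_def scalar_prod_def mult.commute)
      qed (use P' P ec in auto)
      then show ?thesis using PW[of "vec r (\<lambda>i. v $ i)"] eW W' by simp
    qed
    ultimately have "ok (Suc r)" unfolding ok_def using P' by blast
    with max show False by simp
  qed
  with P iso PW show ?thesis using that by blast
qed

section \<open>Unitary representations\<close>

lemma unitary_rep_iff:
  "unitary_rep G m \<Psi> \<longleftrightarrow>
     (\<forall>x\<in>carrier G. unitary_mat m (\<Psi> x)) \<and>
     (\<forall>x\<in>carrier G. \<forall>y\<in>carrier G. \<Psi> (x \<otimes>\<^bsub>G\<^esub> y) = \<Psi> x * \<Psi> y)"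
  by (auto simp: unitary_rep_def hom_def unitary_group_def ring_mat_def)

context group
begin

lemma unitary_rep_carrier:
  "unitary_rep G m \<Psi> \<Longrightarrow> x \<in> carrier G \<Longrightarrow> \<Psi> x \<in> carrier_mat m m"
  by (auto simp: unitary_rep_iff unitary_mat_def)

lemma unitary_rep_mult:
  "unitary_rep G m \<Psi> \<Longrightarrow> x \<in> carrier G \<Longrightarrow> y \<in> carrier G \<Longrightarrow> \<Psi> (x \<otimes> y) = \<Psi> x * \<Psi> y"
  by (auto simp: unitary_rep_iff)

lemma unitary_rep_adjoint_mult:
  assumes "unitary_rep G m \<Psi>" "x \<in> carrier G"
  shows "mat_adjoint (\<Psi> x) * \<Psi> x = 1\<^sub>m m"
proof -
  have "unitary_mat m (\<Psi> x)" using assms by (simp add: unitary_rep_iff)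
  then have "\<Psi> x \<in> carrier_mat m m" "inverts_mat (mat_adjoint (\<Psi> x)) (\<Psi> x)"
    by (simp_all add: unitary_mat_def)
  then show ?thesis by (simp add: inverts_mat_def)
qed

text \<open>Membership in \<open>hom\<close> only gives multiplicativity, so the value at the
  identity has to be derived: it is idempotent, and its adjoint is a left inverse that cancels one
  factor.\<close>

lemma unitary_rep_one:
  assumes u: "unitary_rep G m \<Psi>"
  shows "\<Psi> \<one> = 1\<^sub>m m"
proof -
  note c = unitary_rep_carrier[OF u one_closed]
  have "\<Psi> \<one> = (mat_adjoint (\<Psi> \<one>) * \<Psi> \<one>) * \<Psi> \<one>"
    using unitary_rep_adjoint_mult[OF u one_closed] c by simp
  also have "\<dots> = mat_adjoint (\<Psi> \<one>) * (\<Psi> \<one> * \<Psi> \<one>)"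
    using c by (intro assoc_mult_mat) auto
  also have "\<Psi> \<one> * \<Psi> \<one> = \<Psi> \<one>"
    using unitary_rep_mult[OF u one_closed one_closed] by simp
  finally show ?thesis using unitary_rep_adjoint_mult[OF u one_closed] by simp
qed

text \<open>One side is a left inverse of \<open>\<Psi> x\<close>, the other a right inverse, so
  they coincide.\<close>

lemma unitary_rep_adjoint:
  assumes u: "unitary_rep G m \<Psi>" and x: "x \<in> carrier G"
  shows "mat_adjoint (\<Psi> x) = \<Psi> (inv x)"
proof -
  note c = unitary_rep_carrier[OF u x] and ci = unitary_rep_carrier[OF u inv_closed[OF x]]
  have "mat_adjoint (\<Psi> x) = mat_adjoint (\<Psi> x) * (\<Psi> x * \<Psi> (inv x))"
    unfolding unitary_rep_mult[OF u x inv_closed[OF x], symmetric] r_inv[OF x] unitary_rep_one[OF u]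
    using right_mult_one_mat[OF mat_adjoint_carrier[OF c]] by simp
  also have "\<dots> = (mat_adjoint (\<Psi> x) * \<Psi> x) * \<Psi> (inv x)"
    using c ci by (intro assoc_mult_mat[symmetric]) auto
  also have "\<dots> = \<Psi> (inv x)" using unitary_rep_adjoint_mult[OF u x] ci by simp
  finally show ?thesis .
qed

text \<open>Once the adjoint is the value at the inverse, unitarity is multiplicativity applied to
  \<open>x\<close> and \<open>inv x\<close>.\<close>

lemma unitary_repI:
  assumes c: "\<And>x. x \<in> carrier G \<Longrightarrow> \<Psi> x \<in> carrier_mat m m"
    and h: "\<And>x y. x \<in> carrier G \<Longrightarrow> y \<in> carrier G \<Longrightarrow> \<Psi> (x \<otimes> y) = \<Psi> x * \<Psi> y"
    and one: "\<Psi> \<one> = 1\<^sub>m m"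
    and adj: "\<And>x. x \<in> carrier G \<Longrightarrow> mat_adjoint (\<Psi> x) = \<Psi> (inv x)"
  shows "unitary_rep G m \<Psi>"
  unfolding unitary_rep_iff unitary_mat_def inverts_mat_def
proof (intro conjI ballI)
  fix x assume x: "x \<in> carrier G"
  show "\<Psi> x \<in> carrier_mat m m" by (rule c[OF x])
  show "\<Psi> x * mat_adjoint (\<Psi> x) = 1\<^sub>m (dim_row (\<Psi> x))"
    using h[OF x inv_closed[OF x]] c[OF x] x by (simp add: adj one)
  show "mat_adjoint (\<Psi> x) * \<Psi> x = 1\<^sub>m (dim_row (mat_adjoint (\<Psi> x)))"
    using h[OF inv_closed[OF x] x] c[OF x] c[OF inv_closed[OF x]] x by (simp add: adj one)
qed (rule h)

text \<open>This is the restriction of \<open>\<Psi>\<close> to the column space of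
  \<open>P\<close>, written in the orthonormal basis of the columns. The hypothesis
  \<open>inv\<close> expresses invariance of that space; it removes the projection that arises
  between two factors.\<close>

lemma unitary_rep_compress:
  assumes u: "unitary_rep G m \<Psi>" and P: "P \<in> carrier_mat m r"
    and iso: "mat_adjoint P * P = 1\<^sub>m r"
    and inv: "\<And>x. x \<in> carrier G \<Longrightarrow> P * (mat_adjoint P * (\<Psi> x * P)) = \<Psi> x * P"
  shows "unitary_rep G r (\<lambda>x. mat_adjoint P * (\<Psi> x * P))"
proof (rule unitary_repI)
  note Pa = mat_adjoint_carrier[OF P]
  note c = unitary_rep_carrier[OF u]
  show "mat_adjoint P * (\<Psi> x * P) \<in> carrier_mat r r" if "x \<in> carrier G" for x
    using c[OF that] P Pa by auto
  show "mat_adjoint P * (\<Psi> (x \<otimes> y) * P) = mat_adjoint P * (\<Psi> x * P) * (mat_adjoint P * (\<Psi> y * P))"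
    if x: "x \<in> carrier G" and y: "y \<in> carrier G" for x y
  proof -
    have yP: "\<Psi> y * P \<in> carrier_mat m r" and xP: "\<Psi> x * P \<in> carrier_mat m r"
      using c[OF x] c[OF y] P by auto
    have m: "mat_adjoint P * (\<Psi> y * P) \<in> carrier_mat r r" using Pa yP by auto
    have "mat_adjoint P * (\<Psi> x * P) * (mat_adjoint P * (\<Psi> y * P))
        = mat_adjoint P * (\<Psi> x * P * (mat_adjoint P * (\<Psi> y * P)))"
      by (rule assoc_mult_mat[OF Pa xP m])
    also have "\<Psi> x * P * (mat_adjoint P * (\<Psi> y * P)) = \<Psi> x * (P * (mat_adjoint P * (\<Psi> y * P)))"
      by (rule assoc_mult_mat[OF c[OF x] P m])
    also have "\<dots> = \<Psi> x * \<Psi> y * P"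
      unfolding inv[OF y] by (rule assoc_mult_mat[OF c[OF x] c[OF y] P, symmetric])
    finally show ?thesis unfolding unitary_rep_mult[OF u x y] ..
  qed
  show "mat_adjoint P * (\<Psi> \<one> * P) = 1\<^sub>m r"
    using P iso by (simp add: unitary_rep_one[OF u])
  show "mat_adjoint (mat_adjoint P * (\<Psi> x * P)) = mat_adjoint P * (\<Psi> (inv x) * P)"
    if x: "x \<in> carrier G" for x
  proof -
    have xP: "\<Psi> x * P \<in> carrier_mat m r" using c[OF x] P by auto
    have "mat_adjoint (mat_adjoint P * (\<Psi> x * P)) = mat_adjoint P * mat_adjoint (\<Psi> x) * P"
      by (simp add: mat_adjoint_mult[OF Pa xP] mat_adjoint_mult[OF c[OF x] P])
    also have "\<dots> = mat_adjoint P * (mat_adjoint (\<Psi> x) * P)"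
      using assoc_mult_mat[OF Pa mat_adjoint_carrier[OF c[OF x]] P] .
    finally show ?thesis unfolding unitary_rep_adjoint[OF u x] .
  qed
qed

end

lemma mat_eqI_mult_vec:
  fixes A B :: "complex mat"
  assumes A: "A \<in> carrier_mat m n" and B: "B \<in> carrier_mat m n"
    and eq: "\<And>v. v \<in> carrier_vec n \<Longrightarrow> A *\<^sub>v v = B *\<^sub>v v"
  shows "A = B"
proof (rule eq_matI)
  fix i j assume "i < dim_row B" "j < dim_col B"
  then have ij: "i < m" "j < n" using B by auto
  have "(A *\<^sub>v unit_vec n j) $ i = (B *\<^sub>v unit_vec n j) $ i" using eq[of "unit_vec n j"] by simp
  then show "A $$ (i, j) = B $$ (i, j)" using ij A B by simp
qed (use A B in auto)

section \<open>Schur's lemma\<close>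

text \<open>Schur's lemma for one representation: over the complex numbers \<open>T\<close> has an
  eigenvalue, its eigenspace is invariant because \<open>T\<close> commutes with every
  \<open>\<Psi> x\<close>, and irreducibility makes it the whole space.\<close>

lemma irreducible_commutant_scalar:
  assumes irr: "irreducible_rep G m \<Psi>"
    and c: "\<And>x. x \<in> carrier G \<Longrightarrow> \<Psi> x \<in> carrier_mat m m"
    and T: "T \<in> carrier_mat m m"
    and comm: "\<And>x. x \<in> carrier G \<Longrightarrow> \<Psi> x * T = T * \<Psi> x"
  obtains e where "T = e \<cdot>\<^sub>m 1\<^sub>m m"
proof -
  have m: "m > 0" using irr by (simp add: irreducible_rep_def)
  from spectrum_non_empty[OF T] m obtain e where "eigenvalue T e"
    by (auto simp: spectrum_def)
  then obtain v where v: "v \<in> carrier_vec m" "v \<noteq> 0\<^sub>v m" "T *\<^sub>v v = e \<cdot>\<^sub>v v"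
    using T by (auto simp: eigenvalue_def eigenvector_def)
  define W where "W = {w \<in> carrier_vec m. T *\<^sub>v w = e \<cdot>\<^sub>v w}"
  have "is_subspace m W"
    using T by (auto simp: is_subspace_iff W_def mult_add_distrib_mat_vec[OF T] mult_mat_vec[OF T]
        smult_smult_assoc smult_add_distrib_vec mult.commute)
  moreover have "\<Psi> x *\<^sub>v w \<in> W" if x: "x \<in> carrier G" and w: "w \<in> W" for x w
  proof -
    have wc: "w \<in> carrier_vec m" and Tw: "T *\<^sub>v w = e \<cdot>\<^sub>v w" using w by (auto simp: W_def)
    have "T *\<^sub>v (\<Psi> x *\<^sub>v w) = (T * \<Psi> x) *\<^sub>v w" by (rule assoc_mult_mat_vec[OF T c[OF x] wc, symmetric])
    also have "\<dots> = \<Psi> x *\<^sub>v (T *\<^sub>v w)"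
      unfolding comm[OF x, symmetric] by (rule assoc_mult_mat_vec[OF c[OF x] T wc])
    also have "\<dots> = e \<cdot>\<^sub>v (\<Psi> x *\<^sub>v w)" unfolding Tw by (rule mult_mat_vec[OF c[OF x] wc])
    finally show ?thesis using c[OF x] wc by (auto simp: W_def)
  qed
  ultimately have "W = {0\<^sub>v m} \<or> W = carrier_vec m"
    using irr unfolding irreducible_rep_def by blast
  moreover have "v \<in> W" using v by (simp add: W_def)
  ultimately have W: "W = carrier_vec m" using v by auto
  have "T = e \<cdot>\<^sub>m 1\<^sub>m m"
  proof (rule mat_eqI_mult_vec[OF T])
    fix w :: "complex vec" assume w: "w \<in> carrier_vec m"
    then have "T *\<^sub>v w = e \<cdot>\<^sub>v w" using W by (auto simp: W_def)
    also have "\<dots> = (e \<cdot>\<^sub>m 1\<^sub>m m) *\<^sub>v w" using w by (intro eq_vecI) auto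
    finally show "T *\<^sub>v w = (e \<cdot>\<^sub>m 1\<^sub>m m) *\<^sub>v w" .
  qed simp
  then show ?thesis using that by blast
qed

text \<open>Schur's lemma for two representations. If \<open>T\<close> were nonzero,
  \<open>mat_adjoint T * T\<close> and \<open>T * mat_adjoint T\<close> would each commute with an
  irreducible representation and so be scalar, with a common nonzero scalar. Then a multiple of
  \<open>mat_adjoint T\<close> inverts \<open>T\<close>, which becomes an equivalence.\<close>

lemma (in group) inequivalent_intertwiner_zero:
  assumes u: "unitary_rep G m \<Psi>" "irreducible_rep G m \<Psi>"
    and u': "unitary_rep G l \<Psi>'" "irreducible_rep G l \<Psi>'"
    and ne: "\<not> equivalent_rep G l \<Psi>' m \<Psi>"
    and T: "T \<in> carrier_mat m l"
    and comm: "\<And>x. x \<in> carrier G \<Longrightarrow> \<Psi> x * T = T * \<Psi>' x"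
  shows "T = 0\<^sub>m m l"
proof (rule ccontr)
  assume T0: "T \<noteq> 0\<^sub>m m l"
  note c = unitary_rep_carrier[OF u(1)] and c' = unitary_rep_carrier[OF u'(1)]
  note Ta = mat_adjoint_carrier[OF T]
  \<comment> \<open>The adjoint of the intertwining relation at \<open>inv x\<close>; taking
    adjoints turns values at \<open>inv x\<close> into values at \<open>x\<close>.\<close>
  have comm': "\<Psi>' x * mat_adjoint T = mat_adjoint T * \<Psi> x" if x: "x \<in> carrier G" for x
  proof -
    have xi: "inv x \<in> carrier G" using x by simp
    have "mat_adjoint (\<Psi> (inv x) * T) = mat_adjoint (T * \<Psi>' (inv x))" using comm[OF xi] by simp
    then show ?thesis
      using x by (simp add: mat_adjoint_mult[OF c[OF xi] T] mat_adjoint_mult[OF T c'[OF xi]]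
        unitary_rep_adjoint[OF u(1) xi] unitary_rep_adjoint[OF u'(1) xi])
  qed
  have "\<Psi>' x * (mat_adjoint T * T) = mat_adjoint T * T * \<Psi>' x" if x: "x \<in> carrier G" for x
    using assoc_mult_mat[OF c'[OF x] Ta T] assoc_mult_mat[OF Ta c[OF x] T]
      assoc_mult_mat[OF Ta T c'[OF x]] comm[OF x] comm'[OF x] by simp
  then obtain e where e: "mat_adjoint T * T = e \<cdot>\<^sub>m 1\<^sub>m l"
    using irreducible_commutant_scalar[OF u'(2) c', of "mat_adjoint T * T"] Ta T by auto
  have "\<Psi> x * (T * mat_adjoint T) = T * mat_adjoint T * \<Psi> x" if x: "x \<in> carrier G" for x
    using assoc_mult_mat[OF c[OF x] T Ta] assoc_mult_mat[OF T c'[OF x] Ta]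
      assoc_mult_mat[OF T Ta c[OF x]] comm[OF x] comm'[OF x] by simp
  then obtain f where f: "T * mat_adjoint T = f \<cdot>\<^sub>m 1\<^sub>m m"
    using irreducible_commutant_scalar[OF u(2) c, of "T * mat_adjoint T"] Ta T by auto
  \<comment> \<open>Bracketing \<open>T * mat_adjoint T * T\<close> in two ways compares the two
    scalars.\<close>
  have "e \<cdot>\<^sub>m T = T * (e \<cdot>\<^sub>m 1\<^sub>m l)" using T by (simp add: mult_smult_distrib[OF T one_carrier_mat])
  also have "\<dots> = (f \<cdot>\<^sub>m 1\<^sub>m m) * T" using assoc_mult_mat[OF T Ta T] e f by simp
  also have "\<dots> = f \<cdot>\<^sub>m T" using T by (simp add: mult_smult_assoc_mat[OF one_carrier_mat T])
  finally have ef: "e \<cdot>\<^sub>m T = f \<cdot>\<^sub>m T" .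
  obtain i j where ij: "i < m" "j < l" "T $$ (i, j) \<noteq> 0"
    using T0 T by (metis carrier_matD eq_matI index_zero_mat)
  then have "e = f" using arg_cong[OF ef, of "\<lambda>A. A $$ (i, j)"] T by simp
  have "e \<noteq> 0"
  proof
    assume "e = 0"
    then have "mat_adjoint T * T = 0\<^sub>m l l" unfolding e by (intro eq_matI) auto
    then show False using mat_adjoint_mult_self_eq_0[OF T] T0 by simp
  qed
  define S where "S = (1 / e) \<cdot>\<^sub>m mat_adjoint T"
  have S: "S \<in> carrier_mat l m" using Ta by (simp add: S_def)
  have TS: "T * S = 1\<^sub>m m"
    unfolding S_def mult_smult_distrib[OF T Ta] f using \<open>e = f\<close> \<open>e \<noteq> 0\<close> by (intro eq_matI) auto
  have ST: "S * T = 1\<^sub>m l"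
    unfolding S_def mult_smult_assoc_mat[OF Ta T] e using \<open>e \<noteq> 0\<close> by (intro eq_matI) auto
  have "m = l" by (rule two_sided_inverse_imp_square[OF T S TS ST])
  then have "invertible_mat T"
    unfolding invertible_mat_def inverts_mat_def using T S TS ST by auto
  then have "equivalent_rep G l \<Psi>' m \<Psi>"
    unfolding equivalent_rep_def using T comm by (intro bexI[of _ T]) auto
  with ne show False by simp
qed

text \<open>The entries of \<open>A * (M x * B)\<close> are combinations of those of
  \<open>M x\<close> with coefficients independent of \<open>x\<close>. Vanishing of the weighted
  sums thus passes to equivalent representations, and from the pieces of a decomposition to the
  whole.\<close>

lemma sum_sandwich_eq_0:
  fixes A :: "complex mat"
  assumes A: "A \<in> carrier_mat m r" and B: "B \<in> carrier_mat r' l"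
    and M: "\<And>x. x \<in> X \<Longrightarrow> M x \<in> carrier_mat r r'"
    and z: "\<And>a b. a < r \<Longrightarrow> b < r' \<Longrightarrow> (\<Sum>x\<in>X. f x * M x $$ (a, b)) = 0"
    and ij: "i < m" "j < l"
  shows "(\<Sum>x\<in>X. f x * (A * (M x * B)) $$ (i, j)) = 0"
proof -
  have "(\<Sum>x\<in>X. f x * (A * (M x * B)) $$ (i, j))
      = (\<Sum>x\<in>X. \<Sum>a<r. \<Sum>b<r'. A $$ (i, a) * B $$ (b, j) * (f x * M x $$ (a, b)))"
  proof (rule sum.cong)
    fix x assume x: "x \<in> X"
    note Mx = M[OF x]
    have MB: "M x * B \<in> carrier_mat r l" using Mx B by auto
    have "f x * (A * (M x * B)) $$ (i, j) = f x * (\<Sum>a<r. A $$ (i, a) * (\<Sum>b<r'. M x $$ (a, b) * B $$ (b, j)))"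
      unfolding index_mult_mat_sum[OF A MB ij] using ij by (simp add: index_mult_mat_sum[OF Mx B])
    then show "f x * (A * (M x * B)) $$ (i, j)
        = (\<Sum>a<r. \<Sum>b<r'. A $$ (i, a) * B $$ (b, j) * (f x * M x $$ (a, b)))"
      by (simp add: sum_distrib_left mult_ac)
  qed simp
  also have "\<dots> = (\<Sum>a<r. \<Sum>b<r'. \<Sum>x\<in>X. A $$ (i, a) * B $$ (b, j) * (f x * M x $$ (a, b)))"
    by (subst sum.swap, rule sum.cong[OF refl], subst sum.swap, rule refl)
  also have "\<dots> = (\<Sum>a<r. \<Sum>b<r'. A $$ (i, a) * B $$ (b, j) * (\<Sum>x\<in>X. f x * M x $$ (a, b)))"
    by (simp add: sum_distrib_left)
  also have "\<dots> = 0" by (intro sum.neutral ballI) (simp add: z)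
  finally show ?thesis .
qed

lemma invertible_matE:
  assumes "invertible_mat (T :: complex mat)" "T \<in> carrier_mat m l"
  obtains S where "m = l" "S \<in> carrier_mat m m" "S * T = 1\<^sub>m m" "T * S = 1\<^sub>m m"
proof -
  from assms have ml: "m = l" by (auto simp: invertible_mat_def)
  from assms obtain S where S: "T * S = 1\<^sub>m m" "S * T = 1\<^sub>m (dim_row S)"
    by (auto simp: invertible_mat_def inverts_mat_def)
  have "dim_col S = m" using arg_cong[OF S(1), of dim_col] by simp
  moreover have "dim_row S = m" using arg_cong[OF S(2), of dim_col] assms(2) ml by simp
  ultimately show ?thesis using that S ml by auto
qed

section \<open>Reduction to irreducible representations\<close>

text \<open>One step of complete reducibility: the columns of \<open>P\<close> and \<open>Q\<close>
  are orthonormal bases of a proper nonzero invariant subspace and of its orthogonal complement. The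
  two summands have the shape required by \<open>sum_sandwich_eq_0\<close>.\<close>

lemma (in group) unitary_rep_split:
  assumes u: "unitary_rep G m \<Psi>" and m: "m > 0" and red: "\<not> irreducible_rep G m \<Psi>"
  obtains r q P Q where "r < m" "q < m" "P \<in> carrier_mat m r" "Q \<in> carrier_mat m q"
    "unitary_rep G r (\<lambda>x. mat_adjoint P * (\<Psi> x * P))"
    "unitary_rep G q (\<lambda>x. mat_adjoint Q * (\<Psi> x * Q))"
    "\<And>x. x \<in> carrier G \<Longrightarrow> \<Psi> x = P * (mat_adjoint P * (\<Psi> x * P) * mat_adjoint P)
       + Q * (mat_adjoint Q * (\<Psi> x * Q) * mat_adjoint Q)"
proof -
  note c = unitary_rep_carrier[OF u]
  from red m obtain W where W: "is_subspace m W" and W_inv: "\<And>x v. x \<in> carrier G \<Longrightarrow> v \<in> W \<Longrightarrow> \<Psi> x *\<^sub>v v \<in> W"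
    and W_ne: "W \<noteq> {0\<^sub>v m}" "W \<noteq> carrier_vec m"
    unfolding irreducible_rep_def by blast
  have W_c: "W \<subseteq> carrier_vec m" and W_0: "0\<^sub>v m \<in> W" using W by (auto simp: is_subspace_iff)
  obtain P r where P: "P \<in> carrier_mat m r" and P_iso: "mat_adjoint P * P = 1\<^sub>m r"
    and "\<forall>v\<in>carrier_vec r. P *\<^sub>v v \<in> W" "\<forall>w\<in>W. P *\<^sub>v (mat_adjoint P *\<^sub>v w) = w"
    by (rule subspace_isometry[OF W])
  then have PW: "\<And>v. v \<in> carrier_vec r \<Longrightarrow> P *\<^sub>v v \<in> W"
    and WP: "\<And>w. w \<in> W \<Longrightarrow> P *\<^sub>v (mat_adjoint P *\<^sub>v w) = w" by simp_all
  note Pa = mat_adjoint_carrier[OF P]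
  \<comment> \<open>The orthogonal complement of \<open>W\<close>, because the columns of
    \<open>P\<close> span \<open>W\<close>.\<close>
  define W' where "W' = {v \<in> carrier_vec m. mat_adjoint P *\<^sub>v v = 0\<^sub>v r}"
  have W': "is_subspace m W'" unfolding W'_def by (rule is_subspace_kernel[OF Pa])
  obtain Q q where Q: "Q \<in> carrier_mat m q" and Q_iso: "mat_adjoint Q * Q = 1\<^sub>m q"
    and "\<forall>v\<in>carrier_vec q. Q *\<^sub>v v \<in> W'" "\<forall>w\<in>W'. Q *\<^sub>v (mat_adjoint Q *\<^sub>v w) = w"
    by (rule subspace_isometry[OF W'])
  then have QW: "\<And>v. v \<in> carrier_vec q \<Longrightarrow> Q *\<^sub>v v \<in> W'"
    and WQ: "\<And>w. w \<in> W' \<Longrightarrow> Q *\<^sub>v (mat_adjoint Q *\<^sub>v w) = w" by simp_all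
  note Qa = mat_adjoint_carrier[OF Q]
  have P_inv: "P * (mat_adjoint P * (\<Psi> x * P)) = \<Psi> x * P" if x: "x \<in> carrier G" for x
  proof (rule mat_eqI_mult_vec)
    fix v :: "complex vec" assume v: "v \<in> carrier_vec r"
    have xP: "\<Psi> x * P \<in> carrier_mat m r" using c[OF x] P by auto
    have "(P * (mat_adjoint P * (\<Psi> x * P))) *\<^sub>v v = P *\<^sub>v (mat_adjoint P *\<^sub>v (\<Psi> x *\<^sub>v (P *\<^sub>v v)))"
      using assoc_mult_mat_vec[OF P, of "mat_adjoint P * (\<Psi> x * P)" r v]
        assoc_mult_mat_vec[OF Pa xP v] assoc_mult_mat_vec[OF c[OF x] P v] Pa xP v by auto
    also have "\<dots> = \<Psi> x *\<^sub>v (P *\<^sub>v v)" by (rule WP[OF W_inv[OF x PW[OF v]]])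
    finally show "(P * (mat_adjoint P * (\<Psi> x * P))) *\<^sub>v v = (\<Psi> x * P) *\<^sub>v v"
      using assoc_mult_mat_vec[OF c[OF x] P v] by simp
  qed (use c[OF x] P Pa in auto)
  \<comment> \<open>The complement is invariant because \<open>\<Psi> x\<close> is the adjoint of
    \<open>\<Psi> (inv x)\<close>, which preserves \<open>W\<close>.\<close>
  have W'_inv: "\<Psi> x *\<^sub>v w \<in> W'" if x: "x \<in> carrier G" and w: "w \<in> W'" for x w
  proof -
    have wc: "w \<in> carrier_vec m" and Pw: "mat_adjoint P *\<^sub>v w = 0\<^sub>v r" using w by (auto simp: W'_def)
    have xi: "inv x \<in> carrier G" using x by simp
    define M where "M = mat_adjoint P * (\<Psi> (inv x) * P)"
    have M: "M \<in> carrier_mat r r" using Pa P c[OF xi] by (auto simp: M_def)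
    have "mat_adjoint (\<Psi> (inv x) * P) = mat_adjoint (P * M)" unfolding M_def P_inv[OF xi] ..
    then have eq: "mat_adjoint P * \<Psi> x = mat_adjoint M * mat_adjoint P"
      using x by (simp add: mat_adjoint_mult[OF c[OF xi] P] mat_adjoint_mult[OF P M] unitary_rep_adjoint[OF u xi])
    have "mat_adjoint P *\<^sub>v (\<Psi> x *\<^sub>v w) = (mat_adjoint P * \<Psi> x) *\<^sub>v w"
      by (rule assoc_mult_mat_vec[OF Pa c[OF x] wc, symmetric])
    also have "\<dots> = mat_adjoint M *\<^sub>v (mat_adjoint P *\<^sub>v w)"
      unfolding eq by (rule assoc_mult_mat_vec[OF mat_adjoint_carrier[OF M] Pa wc])
    also have "\<dots> = 0\<^sub>v r" unfolding Pw using M by (intro eq_vecI) auto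
    finally show ?thesis using c[OF x] wc by (auto simp: W'_def)
  qed
  have Q_inv: "Q * (mat_adjoint Q * (\<Psi> x * Q)) = \<Psi> x * Q" if x: "x \<in> carrier G" for x
  proof (rule mat_eqI_mult_vec)
    fix v :: "complex vec" assume v: "v \<in> carrier_vec q"
    have xQ: "\<Psi> x * Q \<in> carrier_mat m q" using c[OF x] Q by auto
    have "(Q * (mat_adjoint Q * (\<Psi> x * Q))) *\<^sub>v v = Q *\<^sub>v (mat_adjoint Q *\<^sub>v (\<Psi> x *\<^sub>v (Q *\<^sub>v v)))"
      using assoc_mult_mat_vec[OF Q, of "mat_adjoint Q * (\<Psi> x * Q)" q v]
        assoc_mult_mat_vec[OF Qa xQ v] assoc_mult_mat_vec[OF c[OF x] Q v] Qa xQ v by auto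
    also have "\<dots> = \<Psi> x *\<^sub>v (Q *\<^sub>v v)" by (rule WQ[OF W'_inv[OF x QW[OF v]]])
    finally show "(Q * (mat_adjoint Q * (\<Psi> x * Q))) *\<^sub>v v = (\<Psi> x * Q) *\<^sub>v v"
      using assoc_mult_mat_vec[OF c[OF x] Q v] by simp
  qed (use c[OF x] Q Qa in auto)
  have PQ: "mat_adjoint P * Q = 0\<^sub>m r q"
  proof (rule mat_eqI_mult_vec)
    fix v :: "complex vec" assume v: "v \<in> carrier_vec q"
    then show "(mat_adjoint P * Q) *\<^sub>v v = 0\<^sub>m r q *\<^sub>v v"
      using QW[OF v] by (auto simp: W'_def assoc_mult_mat_vec[OF Pa Q v])
  qed (use Pa Q in auto)
  have QP: "mat_adjoint Q * P = 0\<^sub>m q r"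
  proof -
    have "mat_adjoint Q * P = mat_adjoint (mat_adjoint P * Q)" by (simp add: mat_adjoint_mult[OF Pa Q])
    also have "\<dots> = 0\<^sub>m q r" unfolding PQ by (rule eq_matI) auto
    finally show ?thesis .
  qed
  have PPa: "P * mat_adjoint P \<in> carrier_mat m m" and QQa: "Q * mat_adjoint Q \<in> carrier_mat m m"
    using P Pa Q Qa by auto
  \<comment> \<open>Orthogonal decomposition: subtracting from \<open>v\<close> its projection onto
    \<open>W\<close> leaves a vector of \<open>W'\<close>, and this is also the projection of
    \<open>v\<close> onto \<open>W'\<close>.\<close>
  have one: "P * mat_adjoint P + Q * mat_adjoint Q = 1\<^sub>m m"
  proof (rule mat_eqI_mult_vec)
    fix v :: "complex vec" assume v: "v \<in> carrier_vec m"
    define z where "z = mat_adjoint P *\<^sub>v v"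
    have z: "z \<in> carrier_vec r" using Pa v by (auto simp: z_def)
    have Pz: "P *\<^sub>v z \<in> carrier_vec m" using P z by auto
    define w where "w = v - P *\<^sub>v z"
    have w: "w \<in> carrier_vec m" using v Pz by (simp add: w_def)
    have "mat_adjoint P *\<^sub>v w = z - mat_adjoint P *\<^sub>v (P *\<^sub>v z)"
      unfolding w_def z_def by (rule mult_minus_distrib_mat_vec[OF Pa v]) (use Pz z_def in simp)
    also have "\<dots> = 0\<^sub>v r"
      unfolding assoc_mult_mat_vec[OF Pa P z, symmetric] P_iso using z by simp
    finally have "w \<in> W'" using w by (simp add: W'_def)
    have "mat_adjoint Q *\<^sub>v w = mat_adjoint Q *\<^sub>v v - mat_adjoint Q *\<^sub>v (P *\<^sub>v z)"
      unfolding w_def by (rule mult_minus_distrib_mat_vec[OF Qa v Pz])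
    also have "mat_adjoint Q *\<^sub>v (P *\<^sub>v z) = 0\<^sub>v q"
      unfolding assoc_mult_mat_vec[OF Qa P z, symmetric] QP using z by (intro eq_vecI) auto
    finally have "mat_adjoint Q *\<^sub>v w = mat_adjoint Q *\<^sub>v v" using Qa v by simp
    then have "Q *\<^sub>v (mat_adjoint Q *\<^sub>v v) = w" using WQ[OF \<open>w \<in> W'\<close>] by simp
    then have "(P * mat_adjoint P + Q * mat_adjoint Q) *\<^sub>v v = P *\<^sub>v z + w"
      unfolding add_mult_distrib_mat_vec[OF PPa QQa v] assoc_mult_mat_vec[OF P Pa v]
        assoc_mult_mat_vec[OF Q Qa v] z_def by simp
    also have "\<dots> = v"
    proof -
      have "p + (v - p) = v" if "p \<in> carrier_vec m" for p
        using v that by (intro eq_vecI) auto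
      from this[OF Pz] show ?thesis by (simp add: w_def)
    qed
    finally show "(P * mat_adjoint P + Q * mat_adjoint Q) *\<^sub>v v = 1\<^sub>m m *\<^sub>v v" using v by simp
  qed (use PPa QQa in auto)
  \<comment> \<open>Traces in \<open>one\<close> give \<open>r + q = m\<close>, so both degrees are
    below \<open>m\<close> as soon as neither is zero.\<close>
  have "of_nat (r + q) = (\<Sum>i<m. (P * mat_adjoint P) $$ (i, i)) + (\<Sum>i<m. (Q * mat_adjoint Q) $$ (i, i))"
    unfolding sum_diag_mult_comm[OF P Pa] sum_diag_mult_comm[OF Q Qa] P_iso Q_iso by simp
  also have "\<dots> = (\<Sum>i<m. (P * mat_adjoint P + Q * mat_adjoint Q) $$ (i, i))"
    unfolding sum.distrib[symmetric] using P Q by (intro sum.cong) auto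
  also have "\<dots> = of_nat m" unfolding one by simp
  finally have rq: "r + q = m" unfolding of_nat_eq_iff .
  have "r \<noteq> 0"
  proof
    assume r: "r = 0"
    have "w = 0\<^sub>v m" if w: "w \<in> W" for w
    proof -
      have "P *\<^sub>v (mat_adjoint P *\<^sub>v w) = 0\<^sub>v m"
        using P r by (intro eq_vecI) (auto simp: scalar_prod_def)
      then show ?thesis using WP[OF w] by simp
    qed
    then have "W \<subseteq> {0\<^sub>v m}" by (intro subsetI) (simp only: singleton_iff)
    then have "W = {0\<^sub>v m}" using W_0 by (intro equalityI) simp_all
    then show False using W_ne(1) by (rule notE[rotated])
  qed
  \<comment> \<open>For \<open>q = 0\<close> the isometry \<open>P\<close> is square, hence unitary,
    and \<open>W\<close> would be the whole space.\<close>
  moreover have "q \<noteq> 0"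
  proof
    assume "q = 0"
    then have "r = m" using rq by simp
    then have PP: "P * mat_adjoint P = 1\<^sub>m m" 
      using mat_mult_left_right_inverse[of "mat_adjoint P" m P] P Pa P_iso by simp
    have "v \<in> W" if v: "v \<in> carrier_vec m" for v
    proof -
      have "P *\<^sub>v (mat_adjoint P *\<^sub>v v) = v" unfolding assoc_mult_mat_vec[OF P Pa v, symmetric] PP using v by simp
      moreover have "P *\<^sub>v (mat_adjoint P *\<^sub>v v) \<in> W" by (rule PW) (use Pa v in auto)
      ultimately show ?thesis by simp
    qed
    then have "carrier_vec m \<subseteq> W" by (rule subsetI)
    then show False using W_ne(2) equalityI[OF W_c] by simp
  qed
  moreover have "\<Psi> x = P * (mat_adjoint P * (\<Psi> x * P) * mat_adjoint P)
       + Q * (mat_adjoint Q * (\<Psi> x * Q) * mat_adjoint Q)" if x: "x \<in> carrier G" for x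
  proof -
    have xP: "\<Psi> x * P \<in> carrier_mat m r" and xQ: "\<Psi> x * Q \<in> carrier_mat m q" using c[OF x] P Q by auto
    have M: "mat_adjoint P * (\<Psi> x * P) \<in> carrier_mat r r" "mat_adjoint Q * (\<Psi> x * Q) \<in> carrier_mat q q"
      using xP xQ Pa Qa by auto
    have "\<Psi> x = \<Psi> x * (P * mat_adjoint P + Q * mat_adjoint Q)" unfolding one using c[OF x] by simp
    also have "\<dots> = \<Psi> x * (P * mat_adjoint P) + \<Psi> x * (Q * mat_adjoint Q)"
      by (rule mult_add_distrib_mat[OF c[OF x] PPa QQa])
    also have "\<Psi> x * (P * mat_adjoint P) = P * (mat_adjoint P * (\<Psi> x * P) * mat_adjoint P)"
      using assoc_mult_mat[OF c[OF x] P Pa] assoc_mult_mat[OF P M(1) Pa] P_inv[OF x] by simp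
    also have "\<Psi> x * (Q * mat_adjoint Q) = Q * (mat_adjoint Q * (\<Psi> x * Q) * mat_adjoint Q)"
      using assoc_mult_mat[OF c[OF x] Q Qa] assoc_mult_mat[OF Q M(2) Qa] Q_inv[OF x] by simp
    finally show ?thesis .
  qed
  ultimately show ?thesis
    using that[of r q P Q] rq P Q unitary_rep_compress[OF u P P_iso P_inv]
      unitary_rep_compress[OF u Q Q_iso Q_inv] by auto
qed

text \<open>Strong induction on the degree: an irreducible \<open>\<Psi>\<close> is equivalent to
  some \<open>\<Phi> k\<close>, and a reducible one splits into two representations of smaller
  degree.\<close>

lemma (in group) complete_irreps_annihilator:
  assumes compl: "complete_irreps G s d \<Phi>"
    and z: "\<And>k i j. k < s \<Longrightarrow> i < d k \<Longrightarrow> j < d k \<Longrightarrow> (\<Sum>x\<in>carrier G. f x * \<Phi> k x $$ (i, j)) = 0"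
    and u: "unitary_rep G m \<Psi>" and ij: "i < m" "j < m"
  shows "(\<Sum>x\<in>carrier G. f x * \<Psi> x $$ (i, j)) = 0"
  using u ij
proof (induction m arbitrary: \<Psi> i j rule: less_induct)
  case (less m)
  note c = unitary_rep_carrier[OF less.prems(1)]
  show ?case
  proof (cases "irreducible_rep G m \<Psi>")
    case True
    then obtain k where k: "k < s" and "equivalent_rep G m \<Psi> (d k) (\<Phi> k)"
      using compl less.prems(1) unfolding complete_irreps_def by blast
    then obtain T where T: "T \<in> carrier_mat (d k) m" and "invertible_mat T"
      and TP: "\<And>x. x \<in> carrier G \<Longrightarrow> T * \<Psi> x = \<Phi> k x * T"
      by (auto simp: equivalent_rep_def)
    then obtain S where dk: "d k = m" and S: "S \<in> carrier_mat m m" "S * T = 1\<^sub>m m"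
      by (metis invertible_matE)
    have uk: "unitary_rep G (d k) (\<Phi> k)" using compl k by (simp add: complete_irreps_def)
    have T': "T \<in> carrier_mat m m" using T dk by simp
    have "\<Psi> x = S * (\<Phi> k x * T)" if x: "x \<in> carrier G" for x
      using assoc_mult_mat[OF S(1) T' c[OF x]] TP[OF x] S(2) c[OF x] by simp
    then have "(\<Sum>x\<in>carrier G. f x * \<Psi> x $$ (i, j)) = (\<Sum>x\<in>carrier G. f x * (S * (\<Phi> k x * T)) $$ (i, j))"
      by (intro sum.cong) auto
    also have "\<dots> = 0"
      by (rule sum_sandwich_eq_0[OF S(1) T' _ _ less.prems(2,3)])
        (use unitary_rep_carrier[OF uk] z[OF k] dk in auto)
    finally show ?thesis .
  next
    case False
    \<comment> \<open>The bound \<open>i < m\<close> excludes degree 0, which counts as not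
      irreducible but cannot be split.\<close>
    have "m > 0" using less.prems(2) by simp
    from unitary_rep_split[OF less.prems(1) this False] obtain r q P Q where rq: "r < m" "q < m"
      and P: "P \<in> carrier_mat m r" and Q: "Q \<in> carrier_mat m q"
      and uP: "unitary_rep G r (\<lambda>x. mat_adjoint P * (\<Psi> x * P))"
      and uQ: "unitary_rep G q (\<lambda>x. mat_adjoint Q * (\<Psi> x * Q))"
      and split: "\<And>x. x \<in> carrier G \<Longrightarrow> \<Psi> x = P * (mat_adjoint P * (\<Psi> x * P) * mat_adjoint P)
       + Q * (mat_adjoint Q * (\<Psi> x * Q) * mat_adjoint Q)" by metis
    have "(\<Sum>x\<in>carrier G. f x * \<Psi> x $$ (i, j)) =
      (\<Sum>x\<in>carrier G. f x * (P * (mat_adjoint P * (\<Psi> x * P) * mat_adjoint P)) $$ (i, j)) +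
      (\<Sum>x\<in>carrier G. f x * (Q * (mat_adjoint Q * (\<Psi> x * Q) * mat_adjoint Q)) $$ (i, j))"
      unfolding sum.distrib[symmetric]
    proof (rule sum.cong)
      fix x assume x: "x \<in> carrier G"
      show "f x * \<Psi> x $$ (i, j) =
        f x * (P * (mat_adjoint P * (\<Psi> x * P) * mat_adjoint P)) $$ (i, j) +
        f x * (Q * (mat_adjoint Q * (\<Psi> x * Q) * mat_adjoint Q)) $$ (i, j)"
        by (subst split[OF x]) (use P Q less.prems(2,3) in \<open>simp add: distrib_left\<close>)
    qed simp
    also have "\<dots> = 0 + 0"
      by (intro arg_cong2[of _ _ _ _ "(+)"] sum_sandwich_eq_0[OF P mat_adjoint_carrier[OF P]]
          sum_sandwich_eq_0[OF Q mat_adjoint_carrier[OF Q]] less.IH[OF rq(1) uP] less.IH[OF rq(2) uQ]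
          unitary_rep_carrier[OF uP] unitary_rep_carrier[OF uQ] less.prems(2,3))
    finally show ?thesis by simp
  qed
qed

section \<open>The regular representation and separation of functions on the group\<close>

text \<open>The left regular representation by permutation matrices: column \<open>j\<close> has its
  1 in the row belonging to \<open>x \<otimes> g j\<close>.\<close>

lemma (in group) unitary_rep_regular:
  assumes g: "bij_betw g {..<n} (carrier G)"
  shows "unitary_rep G n (\<lambda>x. mat n n (\<lambda>(i, j). if g i = x \<otimes> g j then 1 else 0))"
    (is "unitary_rep G n ?R")
proof (rule unitary_repI)
  have gc: "g i \<in> carrier G" if "i < n" for i using g that by (auto simp: bij_betw_def)
  have ginj: "g i = g j \<longleftrightarrow> i = j" if "i < n" "j < n" for i j
    using g that by (auto simp: bij_betw_def inj_on_def)
  show "?R x \<in> carrier_mat n n" for x by simp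
  show "?R (x \<otimes> y) = ?R x * ?R y" if x: "x \<in> carrier G" and y: "y \<in> carrier G" for x y
  proof (rule eq_matI)
    fix i j assume "i < dim_row (?R x * ?R y)" "j < dim_col (?R x * ?R y)"
    then have ij: "i < n" "j < n" by auto
    \<comment> \<open>The permutation for \<open>y\<close> sends \<open>j\<close> to
      \<open>k\<close>, so only the summand \<open>l = k\<close> of the product survives.\<close>
    obtain k where k: "k < n" "g k = y \<otimes> g j"
      using g y gc[OF ij(2)] by (metis bij_betw_def imageE lessThan_iff m_closed)
    have gk: "g l = y \<otimes> g j \<longleftrightarrow> l = k" if "l < n" for l
      using ginj[OF that k(1)] k(2) by simp
    have "(?R x * ?R y) $$ (i, j) = (\<Sum>l<n. ?R x $$ (i, l) * ?R y $$ (l, j))"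
      by (rule index_mult_mat_sum) (use ij in auto)
    also have "\<dots> = (\<Sum>l<n. if l = k then (if g i = x \<otimes> g k then 1 else 0) else 0)"
      using ij k(2) gk by (intro sum.cong) auto
    also have "\<dots> = ?R (x \<otimes> y) $$ (i, j)" using ij k x y gc by (simp add: m_assoc)
    finally show "?R (x \<otimes> y) $$ (i, j) = (?R x * ?R y) $$ (i, j)" ..
  qed auto
  show "?R \<one> = 1\<^sub>m n" by (rule eq_matI) (auto simp: gc ginj)
  show "mat_adjoint (?R x) = ?R (inv x)" if x: "x \<in> carrier G" for x
  proof (rule eq_matI)
    fix i j assume "i < dim_row (?R (inv x))" "j < dim_col (?R (inv x))"
    then have ij: "i < n" "j < n" by auto
    have "g j = x \<otimes> g i \<longleftrightarrow> g i = inv x \<otimes> g j"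
      using x gc[OF ij(1)] gc[OF ij(2)] by (metis inv_closed inv_solve_left)
    then show "mat_adjoint (?R x) $$ (i, j) = ?R (inv x) $$ (i, j)" using ij by simp
  qed auto
qed

text \<open>In the regular representation the entry in the row of \<open>y\<close> and the column of
  the identity is 1 exactly at \<open>x = y\<close>, so the sum that is known to vanish equals
  \<open>f y\<close>.\<close>

lemma (in group) complete_irreps_separate:
  assumes compl: "complete_irreps G s d \<Phi>" and fin: "finite (carrier G)"
    and z: "\<And>k i j. k < s \<Longrightarrow> i < d k \<Longrightarrow> j < d k \<Longrightarrow> (\<Sum>x\<in>carrier G. f x * \<Phi> k x $$ (i, j)) = 0"
    and y: "y \<in> carrier G"
  shows "f y = 0"
proof -
  obtain g where g: "bij_betw g {..<card (carrier G)} (carrier G)"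
    using ex_bij_betw_nat_finite[OF fin] by (auto simp: atLeast0LessThan)
  have "\<exists>i<card (carrier G). g i = w" if "w \<in> carrier G" for w
  proof -
    have "w \<in> g ` {..<card (carrier G)}" unfolding bij_betw_imp_surj_on[OF g] by (rule that)
    then show ?thesis by (elim imageE) auto
  qed
  then obtain i j where i: "i < card (carrier G)" "g i = y" and j: "j < card (carrier G)" "g j = \<one>"
    using y one_closed by meson
  have "0 = (\<Sum>x\<in>carrier G. f x * (if y = x \<otimes> \<one> then 1 else 0))"
    using complete_irreps_annihilator[OF compl z unitary_rep_regular[OF g] i(1) j(1)] i j by simp
  also have "\<dots> = (\<Sum>x\<in>carrier G. if x = y then f y else 0)" by (intro sum.cong) auto
  also have "\<dots> = f y" using fin y by simp
  finally show ?thesis by simp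
qed

section \<open>Schur orthogonality\<close>

text \<open>\<open>T\<close> is the sum over the group of \<open>\<phi> x\<close> times the matrix
  unit at \<open>(b, c)\<close> times the adjoint of \<open>\<psi> x\<close>. Translating the
  summation variable by \<open>y\<close> trades \<open>\<phi> y\<close> on the left for
  \<open>\<psi> y\<close> on the right.\<close>

lemma (in group) sum_matrix_coeff_intertwines:
  assumes u: "unitary_rep G m \<phi>" and v: "unitary_rep G l \<psi>"
    and y: "y \<in> carrier G" and bc: "b < m" "c < l"
  defines "T \<equiv> mat m l (\<lambda>(a, e). \<Sum>x\<in>carrier G. \<phi> x $$ (a, b) * cnj (\<psi> x $$ (e, c)))"
  shows "\<phi> y * T = T * \<psi> y"
proof (rule eq_matI)
  note cu = unitary_rep_carrier[OF u] and cv = unitary_rep_carrier[OF v]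
  have T: "T \<in> carrier_mat m l" by (simp add: T_def)
  have yi: "inv y \<in> carrier G" using y by simp
  fix a e assume "a < dim_row (T * \<psi> y)" "e < dim_col (T * \<psi> y)"
  then have ae: "a < m" "e < l" using T cv[OF y] by auto
  have "(\<phi> y * T) $$ (a, e) = (\<Sum>r<m. \<Sum>x\<in>carrier G. \<phi> y $$ (a, r) * \<phi> x $$ (r, b) * cnj (\<psi> x $$ (e, c)))"
    unfolding index_mult_mat_sum[OF cu[OF y] T ae]
    using ae by (auto simp: T_def sum_distrib_left mult_ac intro!: sum.cong)
  also have "\<dots> = (\<Sum>x\<in>carrier G. \<phi> (y \<otimes> x) $$ (a, b) * cnj (\<psi> x $$ (e, c)))"
    by (subst sum.swap)
      (auto simp: unitary_rep_mult[OF u y] index_mult_mat_sum[OF cu[OF y] cu ae(1) bc(1)]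
        sum_distrib_right intro!: sum.cong)
  also have "\<dots> = (\<Sum>x\<in>carrier G. \<phi> x $$ (a, b) * cnj (\<psi> (inv y \<otimes> x) $$ (e, c)))"
    by (rule sum.reindex_bij_witness[of _ "\<lambda>x. inv y \<otimes> x" "\<lambda>x. y \<otimes> x"])
      (use y in \<open>auto simp: m_assoc[symmetric]\<close>)
  also have "\<dots> = (\<Sum>x\<in>carrier G. \<Sum>r<l. \<phi> x $$ (a, b) * cnj (\<psi> x $$ (r, c)) * \<psi> y $$ (r, e))"
  proof (rule sum.cong)
    fix x assume x: "x \<in> carrier G"
    have "cnj (\<psi> (inv y) $$ (e, r)) = \<psi> y $$ (r, e)" if "r < l" for r
      using unitary_rep_adjoint[OF v y] ae(2) that cv[OF y]
      by (metis carrier_matD complex_cnj_cnj conjugate_complex_def index_mat_adjoint)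
    then show "\<phi> x $$ (a, b) * cnj (\<psi> (inv y \<otimes> x) $$ (e, c))
        = (\<Sum>r<l. \<phi> x $$ (a, b) * cnj (\<psi> x $$ (r, c)) * \<psi> y $$ (r, e))"
      by (auto simp: unitary_rep_mult[OF v yi x] index_mult_mat_sum[OF cv[OF yi] cv[OF x] ae(2) bc(2)]
          sum_distrib_left mult_ac intro!: sum.cong)
  qed simp
  also have "\<dots> = (T * \<psi> y) $$ (a, e)"
    unfolding index_mult_mat_sum[OF T cv[OF y] ae]
    by (subst sum.swap) (use ae in \<open>auto simp: T_def sum_distrib_right intro!: sum.cong\<close>)
  finally show "(\<phi> y * T) $$ (a, e) = (T * \<psi> y) $$ (a, e)" .
qed (use unitary_rep_carrier[OF u y] unitary_rep_carrier[OF v y] in \<open>auto simp: T_def\<close>)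

text \<open>Schur's lemma enters as the premise \<open>zero\<close> on intertwiners instead of
  through irreducibility; for the matrices \<open>\<phi> k\<close> that premise is later transported
  from \<open>\<Phi> k\<close>.\<close>

lemma (in group) schur_orthogonality_inequivalent:
  assumes u: "unitary_rep G m \<phi>" and v: "unitary_rep G l \<psi>"
    and zero: "\<And>T. T \<in> carrier_mat m l \<Longrightarrow> (\<And>x. x \<in> carrier G \<Longrightarrow> \<phi> x * T = T * \<psi> x) \<Longrightarrow> T = 0\<^sub>m m l"
    and ij: "a < m" "b < m" "e < l" "c < l"
  shows "(\<Sum>x\<in>carrier G. \<phi> x $$ (a, b) * cnj (\<psi> x $$ (e, c))) = 0"
proof -
  let ?T = "mat m l (\<lambda>(a, e). \<Sum>x\<in>carrier G. \<phi> x $$ (a, b) * cnj (\<psi> x $$ (e, c)))"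
  have "?T = 0\<^sub>m m l"
    by (rule zero) (use sum_matrix_coeff_intertwines[OF u v _ ij(2,4)] in auto)
  from arg_cong[OF this, of "\<lambda>A. A $$ (a, e)"] show ?thesis using ij by simp
qed

text \<open>The intertwining group sum is scalar, so only \<open>a = e\<close> contributes;
  unitarity evaluates its trace and brings in the condition \<open>b = c\<close>.\<close>

lemma (in group) schur_orthogonality_irreducible:
  assumes u: "unitary_rep G m \<phi>"
    and scalar: "\<And>T. T \<in> carrier_mat m m \<Longrightarrow> (\<And>x. x \<in> carrier G \<Longrightarrow> \<phi> x * T = T * \<phi> x) \<Longrightarrow> \<exists>t. T = t \<cdot>\<^sub>m 1\<^sub>m m"
    and ij: "a < m" "b < m" "e < m" "c < m"
  shows "(\<Sum>x\<in>carrier G. \<phi> x $$ (a, b) * cnj (\<phi> x $$ (e, c)))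
    = (if a = e \<and> b = c then of_nat (card (carrier G)) / of_nat m else 0)"
proof -
  note cu = unitary_rep_carrier[OF u]
  let ?T = "mat m m (\<lambda>(a, e). \<Sum>x\<in>carrier G. \<phi> x $$ (a, b) * cnj (\<phi> x $$ (e, c)))"
  have "\<exists>t. ?T = t \<cdot>\<^sub>m 1\<^sub>m m"
    by (rule scalar) (use sum_matrix_coeff_intertwines[OF u u _ ij(2,4)] in auto)
  then obtain t where t: "?T = t \<cdot>\<^sub>m 1\<^sub>m m" ..
  have entry: "(\<Sum>x\<in>carrier G. \<phi> x $$ (a, b) * cnj (\<phi> x $$ (e, c))) = (if a = e then t else 0)"
    if "a < m" "e < m" for a e
    using arg_cong[OF t, of "\<lambda>A. A $$ (a, e)"] that by simp
  \<comment> \<open>The scalar is found by taking the trace.\<close>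
  have "of_nat m * t = (\<Sum>r<m. \<Sum>x\<in>carrier G. \<phi> x $$ (r, b) * cnj (\<phi> x $$ (r, c)))"
    by (simp add: entry)
  also have "\<dots> = (\<Sum>x\<in>carrier G. (mat_adjoint (\<phi> x) * \<phi> x) $$ (c, b))"
  proof (subst sum.swap, rule sum.cong)
    fix x assume x: "x \<in> carrier G"
    show "(\<Sum>r<m. \<phi> x $$ (r, b) * cnj (\<phi> x $$ (r, c))) = (mat_adjoint (\<phi> x) * \<phi> x) $$ (c, b)"
      unfolding index_mult_mat_sum[OF mat_adjoint_carrier[OF cu[OF x]] cu[OF x] ij(4,2)]
      using cu[OF x] ij by (auto simp: mult.commute intro!: sum.cong)
  qed simp
  also have "\<dots> = (if b = c then of_nat (card (carrier G)) else 0)"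
    using ij by (simp add: unitary_rep_adjoint_mult[OF u])
  finally have "t = (if b = c then of_nat (card (carrier G)) / of_nat m else 0)"
    using ij by (auto simp: field_simps)
  then show ?thesis using entry[OF ij(1,3)] by simp
qed

section \<open>Passing to matrices in fixed orthonormal bases\<close>

text \<open>The columns of \<open>B\<close> are the basis vectors, so orthonormality makes
  \<open>B\<close> unitary and taking coordinates becomes conjugation by it.\<close>

lemma basis_mat_eq_conjugation:
  assumes onb: "orthonormal_basis m b"
  defines "B \<equiv> mat m m (\<lambda>(i, j). b j $ i)"
  shows "mat_adjoint B * B = 1\<^sub>m m"
    and "M \<in> carrier_mat m m \<Longrightarrow> basis_mat m b M = mat_adjoint B * (M * B)"
proof -
  have B: "B \<in> carrier_mat m m" by (simp add: B_def)
  note Ba = mat_adjoint_carrier[OF B]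
  have bc: "b i \<in> carrier_vec m" if "i < m" for i using onb that by (simp add: orthonormal_basis_def)
  show "mat_adjoint B * B = 1\<^sub>m m"
  proof (rule eq_matI)
    fix i j assume "i < dim_row (1\<^sub>m m :: complex mat)" "j < dim_col (1\<^sub>m m :: complex mat)"
    then have ij: "i < m" "j < m" by auto
    have "(mat_adjoint B * B) $$ (i, j) = b j \<bullet>c b i"
      unfolding index_mult_mat_sum[OF Ba B ij] using ij bc[OF ij(1)]
      by (auto simp: B_def scalar_prod_def atLeast0LessThan mult.commute intro!: sum.cong)
    also have "\<dots> = 1\<^sub>m m $$ (i, j)" using onb ij by (simp add: orthonormal_basis_def)
    finally show "(mat_adjoint B * B) $$ (i, j) = 1\<^sub>m m $$ (i, j)" .
  qed (use B in auto)
  assume M: "M \<in> carrier_mat m m"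
  have MB: "M * B \<in> carrier_mat m m" using M B by auto
  show "basis_mat m b M = mat_adjoint B * (M * B)"
  proof (rule eq_matI)
    fix i j assume "i < dim_row (mat_adjoint B * (M * B))" "j < dim_col (mat_adjoint B * (M * B))"
    then have ij: "i < m" "j < m" using B by auto
    have "(M *\<^sub>v b j) $ k = (M * B) $$ (k, j)" if k: "k < m" for k
      unfolding index_mult_mat_sum[OF M B k ij(2)] using M bc[OF ij(2)] k ij
      by (auto simp: B_def scalar_prod_def atLeast0LessThan intro!: sum.cong)
    then have "(M *\<^sub>v b j) \<bullet>c b i = (mat_adjoint B * (M * B)) $$ (i, j)"
      unfolding index_mult_mat_sum[OF Ba MB ij] using ij bc[OF ij(1)] B
      by (auto simp: B_def scalar_prod_def atLeast0LessThan mult.commute intro!: sum.cong)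
    then show "basis_mat m b M $$ (i, j) = (mat_adjoint B * (M * B)) $$ (i, j)"
      using ij by (simp add: basis_mat_def)
  qed (use B in \<open>auto simp: basis_mat_def\<close>)
qed

locale irreps_in_bases = group G for G :: "('g, 'm) monoid_scheme" (structure) +
  fixes s :: nat and d :: "nat \<Rightarrow> nat" and \<Phi> \<phi> :: "nat \<Rightarrow> 'g \<Rightarrow> complex mat"
    and b :: "nat \<Rightarrow> nat \<Rightarrow> complex vec"
  assumes fin: "finite (carrier G)"
    and compl: "complete_irreps G s d \<Phi>"
    and onb: "\<And>k. k < s \<Longrightarrow> orthonormal_basis (d k) (b k)"
    and \<phi>: "\<And>k x. k < s \<Longrightarrow> x \<in> carrier G \<Longrightarrow> \<phi> k x = basis_mat (d k) (b k) (\<Phi> k x)"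
begin

definition B :: "nat \<Rightarrow> complex mat" where
  "B k = mat (d k) (d k) (\<lambda>(i, j). b k j $ i)"

lemma B_carrier: "B k \<in> carrier_mat (d k) (d k)"
  by (simp add: B_def)

lemmas B_adjoint_carrier = mat_adjoint_carrier[OF B_carrier]

lemma B_adjoint_mult: "k < s \<Longrightarrow> mat_adjoint (B k) * B k = 1\<^sub>m (d k)"
  unfolding B_def by (rule basis_mat_eq_conjugation(1)[OF onb])

lemma B_mult_adjoint: "k < s \<Longrightarrow> B k * mat_adjoint (B k) = 1\<^sub>m (d k)"
  by (rule mat_mult_left_right_inverse[OF B_adjoint_carrier B_carrier B_adjoint_mult])

lemma unitary_rep_\<Phi>: "k < s \<Longrightarrow> unitary_rep G (d k) (\<Phi> k)"
  and irreducible_rep_\<Phi>: "k < s \<Longrightarrow> irreducible_rep G (d k) (\<Phi> k)"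
  using compl by (simp_all add: complete_irreps_def)

lemmas \<Phi>_carrier = unitary_rep_carrier[OF unitary_rep_\<Phi>]

lemma degree_pos: "k < s \<Longrightarrow> d k > 0"
  using irreducible_rep_\<Phi> by (simp add: irreducible_rep_def)

lemma \<phi>_eq: "k < s \<Longrightarrow> x \<in> carrier G \<Longrightarrow> \<phi> k x = mat_adjoint (B k) * (\<Phi> k x * B k)"
  unfolding B_def by (simp add: \<phi> basis_mat_eq_conjugation(2)[OF onb \<Phi>_carrier])

lemma \<phi>_carrier: "k < s \<Longrightarrow> x \<in> carrier G \<Longrightarrow> \<phi> k x \<in> carrier_mat (d k) (d k)"
  by (simp add: \<phi> basis_mat_def)

lemma B_mult_\<phi>:
  assumes k: "k < s" and x: "x \<in> carrier G"
  shows "B k * \<phi> k x = \<Phi> k x * B k"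
proof -
  have "\<Phi> k x * B k \<in> carrier_mat (d k) (d k)"
    by (rule mult_carrier_mat[OF \<Phi>_carrier[OF k x] B_carrier])
  from assoc_mult_mat[OF B_carrier B_adjoint_carrier this] left_mult_one_mat[OF this]
  show ?thesis by (simp add: \<phi>_eq[OF k x] B_mult_adjoint[OF k])
qed

lemma \<phi>_mult_B_adjoint:
  assumes k: "k < s" and x: "x \<in> carrier G"
  shows "\<phi> k x * mat_adjoint (B k) = mat_adjoint (B k) * \<Phi> k x"
proof -
  have "\<phi> k x = (mat_adjoint (B k) * \<Phi> k x) * B k"
    unfolding \<phi>_eq[OF k x] by (rule assoc_mult_mat[OF B_adjoint_carrier \<Phi>_carrier[OF k x] B_carrier, symmetric])
  moreover have M: "mat_adjoint (B k) * \<Phi> k x \<in> carrier_mat (d k) (d k)"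
    by (rule mult_carrier_mat[OF B_adjoint_carrier \<Phi>_carrier[OF k x]])
  ultimately show ?thesis
    using assoc_mult_mat[OF M B_carrier B_adjoint_carrier] right_mult_one_mat[OF M]
    by (simp add: B_mult_adjoint[OF k])
qed

text \<open>The case of \<open>unitary_rep_compress\<close> in which the columns span the whole
  space.\<close>

lemma unitary_rep_\<phi>:
  assumes k: "k < s"
  shows "unitary_rep G (d k) (\<phi> k)"
proof -
  have "unitary_rep G (d k) (\<lambda>x. mat_adjoint (B k) * (\<Phi> k x * B k))"
    by (rule unitary_rep_compress[OF unitary_rep_\<Phi>[OF k] B_carrier B_adjoint_mult[OF k]])
      (simp add: \<phi>_eq[OF k, symmetric] B_mult_\<phi>[OF k])
  then show ?thesis by (simp add: unitary_rep_iff \<phi>_eq[OF k])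
qed

text \<open>Transports intertwiners of the matrices \<open>\<phi>\<close> to intertwiners of
  \<open>\<Phi>\<close>, for which irreducibility and inequivalence are assumed and Schur's lemma
  applies.\<close>

lemma intertwiner_conjugate:
  assumes k: "k < s" and l: "l < s" and x: "x \<in> carrier G"
    and T: "T \<in> carrier_mat (d k) (d l)" and comm: "\<phi> k x * T = T * \<phi> l x"
  shows "\<Phi> k x * (B k * T * mat_adjoint (B l)) = B k * T * mat_adjoint (B l) * \<Phi> l x"
proof -
  have BT: "B k * T \<in> carrier_mat (d k) (d l)" by (rule mult_carrier_mat[OF B_carrier T])
  have "\<Phi> k x * (B k * T * mat_adjoint (B l)) = \<Phi> k x * (B k * T) * mat_adjoint (B l)"
    by (rule assoc_mult_mat[OF \<Phi>_carrier[OF k x] BT B_adjoint_carrier, symmetric])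
  also have "\<Phi> k x * (B k * T) = B k * \<phi> k x * T"
    unfolding B_mult_\<phi>[OF k x] by (rule assoc_mult_mat[OF \<Phi>_carrier[OF k x] B_carrier T, symmetric])
  also have "\<dots> = B k * T * \<phi> l x"
    unfolding assoc_mult_mat[OF B_carrier \<phi>_carrier[OF k x] T] comm
    by (rule assoc_mult_mat[OF B_carrier T \<phi>_carrier[OF l x], symmetric])
  also have "\<dots> * mat_adjoint (B l) = B k * T * (mat_adjoint (B l) * \<Phi> l x)"
    unfolding \<phi>_mult_B_adjoint[OF l x, symmetric]
    by (rule assoc_mult_mat[OF BT \<phi>_carrier[OF l x] B_adjoint_carrier])
  also have "\<dots> = B k * T * mat_adjoint (B l) * \<Phi> l x"
    by (rule assoc_mult_mat[OF BT B_adjoint_carrier \<Phi>_carrier[OF l x], symmetric])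
  finally show ?thesis .
qed

text \<open>Reverses that transport, so that what Schur's lemma says about the conjugate can be read
  off for \<open>T\<close>.\<close>

lemma unconjugate:
  assumes k: "k < s" and l: "l < s" and T: "T \<in> carrier_mat (d k) (d l)"
  shows "mat_adjoint (B k) * (B k * T * mat_adjoint (B l) * B l) = T"
proof -
  have BT: "B k * T \<in> carrier_mat (d k) (d l)" by (rule mult_carrier_mat[OF B_carrier T])
  show ?thesis
    using assoc_mult_mat[OF BT B_adjoint_carrier B_carrier] assoc_mult_mat[OF B_adjoint_carrier B_carrier T] T BT
    by (simp add: B_adjoint_mult[OF k] B_adjoint_mult[OF l])
qed

lemma schur_orthogonality:
  assumes k: "k < s" and l: "l < s" and ij: "i < d k" "j < d k" "i' < d l" "j' < d l"
  shows "(\<Sum>x\<in>carrier G. \<phi> k x $$ (i, j) * cnj (\<phi> l x $$ (i', j')))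
    = (if k = l \<and> i = i' \<and> j = j' then of_nat (card (carrier G)) / of_nat (d k) else 0)"
proof (cases "k = l")
  case True
  have "\<exists>t. T = t \<cdot>\<^sub>m 1\<^sub>m (d k)"
    if T: "T \<in> carrier_mat (d k) (d k)" and comm: "\<And>x. x \<in> carrier G \<Longrightarrow> \<phi> k x * T = T * \<phi> k x" for T
  proof -
    let ?S = "B k * T * mat_adjoint (B k)"
    have "?S \<in> carrier_mat (d k) (d k)"
      by (rule mult_carrier_mat[OF mult_carrier_mat[OF B_carrier T] B_adjoint_carrier])
    then obtain t where S: "?S = t \<cdot>\<^sub>m 1\<^sub>m (d k)"
      using irreducible_commutant_scalar[OF irreducible_rep_\<Phi>[OF k] \<Phi>_carrier[OF k], of ?S]
        intertwiner_conjugate[OF k k _ T comm] by auto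
    have "T = mat_adjoint (B k) * (t \<cdot>\<^sub>m 1\<^sub>m (d k) * B k)"
      using unconjugate[OF k k T] by (simp add: S)
    also have "\<dots> = t \<cdot>\<^sub>m 1\<^sub>m (d k)"
      using mult_smult_assoc_mat[OF one_carrier_mat B_carrier, of t k] mult_smult_distrib[OF B_adjoint_carrier B_carrier, of k t]
        B_carrier[of k] by (simp add: B_adjoint_mult[OF k])
    finally show ?thesis ..
  qed
  from schur_orthogonality_irreducible[OF unitary_rep_\<phi>[OF k] this] show ?thesis
    using ij True by auto
next
  case False
  have "T = 0\<^sub>m (d k) (d l)"
    if T: "T \<in> carrier_mat (d k) (d l)" and comm: "\<And>x. x \<in> carrier G \<Longrightarrow> \<phi> k x * T = T * \<phi> l x" for T
  proof -
    let ?S = "B k * T * mat_adjoint (B l)"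
    have ne: "\<not> equivalent_rep G (d l) (\<Phi> l) (d k) (\<Phi> k)"
      using compl k l False unfolding complete_irreps_def by metis
    have "?S \<in> carrier_mat (d k) (d l)"
      by (rule mult_carrier_mat[OF mult_carrier_mat[OF B_carrier T] B_adjoint_carrier])
    then have "?S = 0\<^sub>m (d k) (d l)"
      by (rule inequivalent_intertwiner_zero[OF unitary_rep_\<Phi>[OF k] irreducible_rep_\<Phi>[OF k]
          unitary_rep_\<Phi>[OF l] irreducible_rep_\<Phi>[OF l] ne])
        (use intertwiner_conjugate[OF k l _ T comm] in auto)
    then have "T = mat_adjoint (B k) * (0\<^sub>m (d k) (d l) * B l)" using unconjugate[OF k l T] by simp
    then show ?thesis
      using left_mult_zero_mat[OF B_carrier] right_mult_zero_mat[OF B_adjoint_carrier] by simp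
  qed
  from schur_orthogonality_inequivalent[OF unitary_rep_\<phi>[OF k] unitary_rep_\<phi>[OF l] this] show ?thesis
    using ij False by auto
qed

text \<open>Each \<open>\<Phi> k x\<close> is \<open>\<phi> k x\<close> placed between
  \<open>B k\<close> and its adjoint, so the hypothesis carries over to
  \<open>\<Phi>\<close>.\<close>

lemma \<phi>_separate:
  assumes z: "\<And>k i j. k < s \<Longrightarrow> i < d k \<Longrightarrow> j < d k \<Longrightarrow> (\<Sum>x\<in>carrier G. f x * \<phi> k x $$ (i, j)) = 0"
    and y: "y \<in> carrier G"
  shows "f y = 0"
proof (rule complete_irreps_separate[OF compl fin _ y])
  fix k i j assume k: "k < s" and ij: "i < d k" "j < d k"
  have "\<Phi> k x = B k * (\<phi> k x * mat_adjoint (B k))" if x: "x \<in> carrier G" for x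
    unfolding \<phi>_mult_B_adjoint[OF k x]
    using assoc_mult_mat[OF B_carrier B_adjoint_carrier \<Phi>_carrier[OF k x]] left_mult_one_mat[OF \<Phi>_carrier[OF k x]]
    by (simp add: B_mult_adjoint[OF k])
  then have "(\<Sum>x\<in>carrier G. f x * \<Phi> k x $$ (i, j))
      = (\<Sum>x\<in>carrier G. f x * (B k * (\<phi> k x * mat_adjoint (B k))) $$ (i, j))"
    by (intro sum.cong) auto
  also have "\<dots> = 0"
    by (rule sum_sandwich_eq_0[OF B_carrier B_adjoint_carrier \<phi>_carrier[OF k] z[OF k] ij])
  finally show "(\<Sum>x\<in>carrier G. f x * \<Phi> k x $$ (i, j)) = 0" .
qed

end

section \<open>Block indices\<close>

text \<open>Labels the rows of a matrix stacked from blocks: entry \<open>q\<close> of the list is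
  the pair of the block number and the position within that block. This avoids offsets by partial
  sums and turns sums over all rows into double sums.\<close>

definition block_index :: "(nat \<Rightarrow> nat) \<Rightarrow> nat \<Rightarrow> (nat \<times> nat) list" where
  "block_index D s = concat (map (\<lambda>k. map (Pair k) [0..<D k]) [0..<s])"

lemma block_index_Suc: "block_index D (Suc s) = block_index D s @ map (Pair s) [0..<D s]"
  by (simp add: block_index_def)

lemma set_block_index: "set (block_index D s) = (SIGMA k:{..<s}. {..<D k})"
  by (auto simp: block_index_def)

lemma distinct_block_index: "distinct (block_index D s)"
proof (induction s)
  case (Suc s)
  have "set (block_index D s) \<inter> set (map (Pair s) [0..<D s]) = {}"
    by (auto simp: set_block_index)
  with Suc show ?case by (simp add: block_index_Suc distinct_map inj_on_def)
qed (simp add: block_index_def)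

lemma nth_block_index:
  assumes "q < length (block_index D s)"
  obtains k p where "block_index D s ! q = (k, p)" "k < s" "p < D k"
proof -
  have "block_index D s ! q \<in> (SIGMA k:{..<s}. {..<D k})"
    using nth_mem[OF assms] by (simp only: set_block_index)
  then show ?thesis using that by auto
qed

lemma ex_nth_block_index:
  assumes "k < s" "p < D k"
  obtains q where "q < length (block_index D s)" "block_index D s ! q = (k, p)"
proof -
  have "(k, p) \<in> set (block_index D s)" using assms by (simp add: set_block_index)
  then show ?thesis using that by (auto simp: in_set_conv_nth)
qed

lemma sum_block_index:
  "(\<Sum>q<length (block_index D s). h (block_index D s ! q)) = (\<Sum>k<s. \<Sum>p<D k. h (k, p))"
proof -
  have "(\<Sum>q<length (block_index D s). h (block_index D s ! q)) = sum h (SIGMA k:{..<s}. {..<D k})"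
    by (rule sum.reindex_bij_betw) (rule bij_betw_nth[OF distinct_block_index refl set_block_index[symmetric]])
  also have "\<dots> = (\<Sum>k<s. \<Sum>p<D k. h (k, p))" by (simp add: sum.Sigma)
  finally show ?thesis .
qed

text \<open>Induction on the number of blocks, splitting off the last one, which matches the way
  \<open>block_index\<close> grows.\<close>

lemma diag_block_mat_block_index:
  assumes "\<And>k. k < s \<Longrightarrow> A k \<in> carrier_mat (D k) (D k)"
  defines "I \<equiv> block_index D s"
  shows "diag_block_mat (map A [0..<s]) \<in> carrier_mat (length I) (length I)"
    and "i < length I \<Longrightarrow> j < length I \<Longrightarrow> diag_block_mat (map A [0..<s]) $$ (i, j) =
      (if fst (I ! i) = fst (I ! j) then A (fst (I ! i)) $$ (snd (I ! i), snd (I ! j)) else 0)"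
  using assms(1) unfolding I_def
proof (induction s arbitrary: i j)
  case 0
  { case 1 show ?case by (simp add: block_index_def) }
  { case 2 then show ?case by (simp add: block_index_def) }
next
  case (Suc s)
  let ?N = "length (block_index D s)" and ?A = "diag_block_mat (map A [0..<s])"
  have A: "?A \<in> carrier_mat ?N ?N" and As: "A s \<in> carrier_mat (D s) (D s)"
    if "\<And>k. k < Suc s \<Longrightarrow> A k \<in> carrier_mat (D k) (D k)"
    using Suc.IH(1) that by auto
  have eq: "diag_block_mat (map A [0..<Suc s]) =
      four_block_mat ?A (0\<^sub>m (dim_row ?A) (dim_col (A s))) (0\<^sub>m (dim_row (A s)) (dim_col ?A)) (A s)"
    by (simp add: diag_block_mat_last Let_def)
  { case 1
    show ?case unfolding eq using A[OF 1] As[OF 1] by (auto simp: block_index_Suc) }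
  { case 2
    have fst_less: "fst (block_index D s ! q) < s" if "q < ?N" for q
      using nth_block_index[OF that] by fastforce
    have IH: "i < ?N \<Longrightarrow> j < ?N \<Longrightarrow> ?A $$ (i, j) = (if fst (block_index D s ! i) = fst (block_index D s ! j)
        then A (fst (block_index D s ! i)) $$ (snd (block_index D s ! i), snd (block_index D s ! j)) else 0)"
      by (rule Suc.IH(2)) (use 2(3) in auto)
    note dims = carrier_matD[OF A[OF 2(3)]] carrier_matD[OF As[OF 2(3)]]
    show ?case
      unfolding eq using 2(1,2) IH fst_less[of i] fst_less[of j]
      by (cases "i < ?N"; cases "j < ?N") (auto simp: block_index_Suc nth_append dims) }
qed

text \<open>For blocks of equal size, quotient and remainder take the place of
  \<open>block_index\<close>.\<close>

lemma diag_block_mat_replicate: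
  assumes A: "A \<in> carrier_mat d d"
  shows "diag_block_mat (replicate m A) \<in> carrier_mat (m * d) (m * d)"
    and "i < m * d \<Longrightarrow> j < m * d \<Longrightarrow> diag_block_mat (replicate m A) $$ (i, j) =
      (if i div d = j div d then A $$ (i mod d, j mod d) else 0)"
proof (induction m arbitrary: i j)
  case (Suc m)
  let ?A = "diag_block_mat (replicate m A)"
  \<comment> \<open>\<open>replicate\<close> grows at the front; moving the new block to the end
    permits splitting off the last block.\<close>
  have eq: "diag_block_mat (replicate (Suc m) A) =
      four_block_mat ?A (0\<^sub>m (dim_row ?A) (dim_col A)) (0\<^sub>m (dim_row A) (dim_col ?A)) A"
    unfolding replicate_Suc replicate_append_same[symmetric]
    by (simp add: diag_block_mat_last Let_def)
  { case 1 show ?case unfolding eq using A Suc.IH(1) by (auto simp: add.commute) }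
  { case 2
    have small: "q div d < m" if "q < m * d" for q
      using that by (rule less_mult_imp_div_less)
    have large: "q div d = m" "q mod d = q - m * d" if "\<not> q < m * d" "q < Suc m * d" for q
    proof -
      show *: "q div d = m" by (rule div_nat_eqI) (use that in \<open>auto simp: mult.commute\<close>)
      show "q mod d = q - m * d" by (simp add: minus_div_mult_eq_mod[symmetric] *)
    qed
    show ?case
      unfolding eq using 2 A Suc.IH(1) Suc.IH(2)[of i j] small[of i] small[of j] large[of i] large[of j]
      by (cases "i < m * d"; cases "j < m * d") auto }
qed auto

section \<open>The Fourier matrix\<close>

context complex_algebra
begin

text \<open>Embedded complex numbers are central, so complex coefficients can be collected across
  products in the algebra.\<close>

lemma scale_one_mult: "scale c 1 * x = scale c x" and mult_scale_one: "x * scale c 1 = scale c x"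
  by (simp_all add: scale_mult_left scale_mult_right)

lemma embed_mat_carrier: "M \<in> carrier_mat m l \<Longrightarrow> embed_mat scale M \<in> carrier_mat m l"
  by (simp add: embed_mat_def)

lemma index_embed_mat:
  "M \<in> carrier_mat m l \<Longrightarrow> i < m \<Longrightarrow> j < l \<Longrightarrow> embed_mat scale M $$ (i, j) = scale (M $$ (i, j)) 1"
  by (simp add: embed_mat_def)

end

locale enumerated_irreps = irreps_in_bases +
  fixes n :: nat and g :: "nat \<Rightarrow> 'a"
  assumes n: "n = Coset.order G" and g: "bij_betw g {..<n} (carrier G)"
begin

abbreviation "I \<equiv> block_index (\<lambda>k. (d k)\<^sup>2) s"

abbreviation "F \<equiv> fourier_mat n g s d \<phi>"

text \<open>Collects both normalising factors of the rows of \<open>F\<close> in block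
  \<open>k\<close>.\<close>

definition weight :: "nat \<Rightarrow> real" where
  "weight k = sqrt (d k) / sqrt n"

text \<open>A row of \<open>F\<close> viewed as a function on the group, so that it can be evaluated
  at products without returning to the enumeration. Remainder and quotient of \<open>p\<close> undo
  the stacking of columns.\<close>

definition coeff :: "nat \<times> nat \<Rightarrow> 'a \<Rightarrow> complex" where
  "coeff = (\<lambda>(k, p) x. of_real (weight k) * \<phi> k x $$ (p mod d k, p div d k))"

lemma n_pos: "n > 0"
  using fin one_closed by (auto simp: n Coset.order_def card_gt_0_iff)

lemma weight_square: "weight k * weight k = d k / n"
  by (simp add: weight_def)

lemma weight_nonzero: "k < s \<Longrightarrow> weight k \<noteq> 0"
  using degree_pos n_pos by (simp add: weight_def)

lemma g_closed: "j < n \<Longrightarrow> g j \<in> carrier G"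
  using g by (auto simp: bij_betw_def)

lemma ex_g:
  assumes "x \<in> carrier G"
  obtains j where "j < n" "g j = x"
proof -
  have "x \<in> g ` {..<n}" unfolding bij_betw_imp_surj_on[OF g] by (rule assms)
  then show ?thesis using that by (elim imageE) auto
qed

lemma fourier_mat_carrier: "F \<in> carrier_mat (length I) n"
  and index_fourier_mat: "q < length I \<Longrightarrow> j < n \<Longrightarrow> F $$ (q, j) = coeff (I ! q) (g j)"
proof -
  have blk: "fourier_block n g (d k) (\<phi> k) \<in> carrier_mat ((d k)\<^sup>2) n" for k
    by (rule carrier_matI) (simp_all add: fourier_block_def)
  \<comment> \<open>The stacked blocks list their rows in the order of \<open>I\<close>.\<close>
  have "concat (map (\<lambda>k. rows (fourier_block n g (d k) (\<phi> k))) [0..<s])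
      = map (\<lambda>(k, p). row (fourier_block n g (d k) (\<phi> k)) p) I"
    by (simp add: block_index_def map_concat rows_def comp_def carrier_matD(1)[OF blk])
  then have F: "F = of_real (1 / sqrt n) \<cdot>\<^sub>m mat_of_rows n (map (\<lambda>(k, p). row (fourier_block n g (d k) (\<phi> k)) p) I)"
    by (simp add: fourier_mat_def)
  show "F \<in> carrier_mat (length I) n" unfolding F by (rule carrier_matI) simp_all
  assume q: "q < length I" and j: "j < n"
  obtain k p where kp: "I ! q = (k, p)" "k < s" "p < (d k)\<^sup>2" using nth_block_index[OF q] by blast
  have p: "p mod d k < d k" "p div d k < d k"
    using kp degree_pos[OF kp(2)] by (auto simp: power2_eq_square less_mult_imp_div_less)
  show "F $$ (q, j) = coeff (I ! q) (g j)"
    unfolding F using q j kp p blk[of k] \<phi>_carrier[OF kp(2) g_closed[OF j]]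
    by (simp add: mat_of_rows_index fourier_block_def mat_of_cols_index fourier_col_def stack_cols_def coeff_def weight_def)
qed

text \<open>The squared weight \<open>d k / n\<close> cancels the constant \<open>n / d k\<close> of
  Schur's relations, and \<open>p\<close> is determined by its quotient and remainder.\<close>

lemma coeff_orthogonality:
  assumes k: "k < s" and p: "p < (d k)\<^sup>2" and l: "l < s" and p': "p' < (d l)\<^sup>2"
  shows "(\<Sum>x\<in>carrier G. coeff (k, p) x * cnj (coeff (l, p') x)) = (if k = l \<and> p = p' then 1 else 0)"
proof -
  have b: "p mod d k < d k" "p div d k < d k" "p' mod d l < d l" "p' div d l < d l"
    using p p' degree_pos[OF k] degree_pos[OF l] by (auto simp: power2_eq_square less_mult_imp_div_less)
  have card: "card (carrier G) = n" by (simp add: n Coset.order_def)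
  have "(\<Sum>x\<in>carrier G. coeff (k, p) x * cnj (coeff (l, p') x))
     = of_real (weight k * weight l) *
       (\<Sum>x\<in>carrier G. \<phi> k x $$ (p mod d k, p div d k) * cnj (\<phi> l x $$ (p' mod d l, p' div d l)))"
    by (simp add: coeff_def sum_distrib_left mult_ac)
  also have "\<dots> = (if k = l \<and> p mod d k = p' mod d l \<and> p div d k = p' div d l then
      of_real (weight k * weight l) * (of_nat n / of_nat (d k)) else 0)"
    unfolding schur_orthogonality[OF k l b] card by auto
  also have "\<dots> = (if k = l \<and> p = p' then 1 else 0)"
  proof (cases "k = l")
    case True
    have "p mod d k = p' mod d k \<and> p div d k = p' div d k \<longleftrightarrow> p = p'"
      by (metis div_mult_mod_eq)
    moreover have "complex_of_real (weight k * weight k) * (of_nat n / of_nat (d k)) = 1"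
      unfolding weight_square using n_pos degree_pos[OF k] by simp
    ultimately show ?thesis using True by simp
  qed simp
  finally show ?thesis .
qed

text \<open>Orthonormality of the rows. The number \<open>length I\<close> of rows is not yet known
  to be \<open>n\<close>, so the other product needs its own argument.\<close>

lemma fourier_mat_mult_adjoint: "F * mat_adjoint F = 1\<^sub>m (length I)"
proof (rule eq_matI)
  note F = fourier_mat_carrier
  fix q r assume "q < dim_row (1\<^sub>m (length I) :: complex mat)" "r < dim_col (1\<^sub>m (length I) :: complex mat)"
  then have qr: "q < length I" "r < length I" by auto
  obtain k p where kp: "I ! q = (k, p)" "k < s" "p < (d k)\<^sup>2" using nth_block_index[OF qr(1)] by blast
  obtain l p' where lp: "I ! r = (l, p')" "l < s" "p' < (d l)\<^sup>2" using nth_block_index[OF qr(2)] by blast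
  have "(F * mat_adjoint F) $$ (q, r) = (\<Sum>j<n. coeff (I ! q) (g j) * cnj (coeff (I ! r) (g j)))"
    unfolding index_mult_mat_sum[OF F mat_adjoint_carrier[OF F] qr]
    using qr F by (auto simp: index_fourier_mat intro!: sum.cong)
  also have "\<dots> = (\<Sum>x\<in>carrier G. coeff (I ! q) x * cnj (coeff (I ! r) x))"
    by (rule sum.reindex_bij_betw[OF g])
  also have "\<dots> = (if I ! q = I ! r then 1 else 0)"
    unfolding kp(1) lp(1) coeff_orthogonality[OF kp(2,3) lp(2,3)] by simp
  also have "\<dots> = 1\<^sub>m (length I) $$ (q, r)"
    using qr nth_eq_iff_index_eq[OF distinct_block_index qr] by simp
  finally show "(F * mat_adjoint F) $$ (q, r) = 1\<^sub>m (length I) $$ (q, r)" .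
qed (use fourier_mat_carrier in auto)

text \<open>Read as a function on the group, \<open>v\<close> is annihilated by every matrix
  coefficient, because each one is a row of \<open>F\<close> up to the nonzero factor
  \<open>weight k\<close>; then \<open>\<phi>_separate\<close> applies.\<close>

lemma fourier_mat_injective:
  assumes v: "v \<in> carrier_vec n" and z: "F *\<^sub>v v = 0\<^sub>v (length I)"
  shows "v = 0\<^sub>v n"
proof -
  note F = fourier_mat_carrier
  define f where "f x = v $ inv_into {..<n} g x" for x
  have fg: "f (g j) = v $ j" if "j < n" for j
    using g that by (simp add: f_def bij_betw_def)
  have "f y = 0" if y: "y \<in> carrier G" for y
  proof (rule \<phi>_separate[OF _ y])
    fix k i j assume k: "k < s" and ij: "i < d k" "j < d k"
    \<comment> \<open>The position of the entry \<open>(i, j)\<close> among the stacked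
      columns.\<close>
    define p where "p = j * d k + i"
    have p_ij: "p mod d k = i" "p div d k = j" using ij by (simp_all add: p_def)
    have "p < Suc j * d k" using ij by (simp add: p_def)
    also have "\<dots> \<le> d k * d k" using ij by (intro mult_right_mono) auto
    finally have "p < (d k)\<^sup>2" by (simp add: power2_eq_square)
    then obtain q where q: "q < length I" "I ! q = (k, p)" using ex_nth_block_index[OF k] by metis
    have "0 = (F *\<^sub>v v) $ q" using z q by simp
    also have "\<dots> = (\<Sum>j<n. f (g j) * coeff (k, p) (g j))"
      using F v q index_fourier_mat[OF q(1)]
      by (auto simp: scalar_prod_def atLeast0LessThan fg mult.commute intro!: sum.cong)
    also have "\<dots> = (\<Sum>x\<in>carrier G. f x * coeff (k, p) x)" by (rule sum.reindex_bij_betw[OF g])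
    also have "\<dots> = of_real (weight k) * (\<Sum>x\<in>carrier G. f x * \<phi> k x $$ (i, j))"
      by (simp add: coeff_def p_ij sum_distrib_left mult_ac)
    finally show "(\<Sum>x\<in>carrier G. f x * \<phi> k x $$ (i, j)) = 0"
      using weight_nonzero[OF k] by simp
  qed
  then show ?thesis using v fg g_closed by (intro eq_vecI) auto
qed

lemma fourier_mat_adjoint_mult: "mat_adjoint F * F = 1\<^sub>m n"
proof (rule mat_eqI_mult_vec)
  note F = fourier_mat_carrier and Fa = mat_adjoint_carrier[OF fourier_mat_carrier]
  show M: "mat_adjoint F * F \<in> carrier_mat n n" by (rule mult_carrier_mat[OF Fa F])
  fix v :: "complex vec" assume v: "v \<in> carrier_vec n"
  define w where "w = (mat_adjoint F * F) *\<^sub>v v"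
  have w: "w \<in> carrier_vec n" unfolding w_def by (rule mult_mat_vec_carrier[OF M v])
  have "F * (mat_adjoint F * F) = F"
    using assoc_mult_mat[OF F Fa F] left_mult_one_mat[OF F] by (simp add: fourier_mat_mult_adjoint)
  then have "F *\<^sub>v w = F *\<^sub>v v"
    using assoc_mult_mat_vec[OF F M v] by (simp add: w_def)
  then have "F *\<^sub>v (w - v) = 0\<^sub>v (length I)"
    using mult_mat_vec_carrier[OF F v] by (simp add: mult_minus_distrib_mat_vec[OF F w v])
  then have z: "w - v = 0\<^sub>v n" using v w by (intro fourier_mat_injective) auto
  have "w = v"
  proof (rule eq_vecI)
    fix i assume i: "i < dim_vec v"
    then have "(w - v) $ i = 0" using z v by simp
    then show "w $ i = v $ i" using i v w by simp
  qed (use v w in simp)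
  then show "(mat_adjoint F * F) *\<^sub>v v = 1\<^sub>m n *\<^sub>v v" using v by (simp add: w_def)
qed simp

text \<open>The degree formula: the squares of the degrees add up to the order of the group.\<close>

lemma length_block_index_eq: "length I = n"
  by (rule two_sided_inverse_imp_square[OF fourier_mat_carrier mat_adjoint_carrier[OF fourier_mat_carrier]
      fourier_mat_mult_adjoint fourier_mat_adjoint_mult])

lemma unitary_fourier_mat: "unitary_mat n F"
  using fourier_mat_carrier fourier_mat_mult_adjoint fourier_mat_adjoint_mult
  by (simp add: unitary_mat_def inverts_mat_def length_block_index_eq)

text \<open>The column relations relabelled by group elements, as needed for arguments of the form
  \<open>x \<otimes> g j\<close>.\<close>

lemma coeff_columns_orthonormal:
  assumes y: "y \<in> carrier G" and z: "z \<in> carrier G"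
  shows "(\<Sum>q<length I. cnj (coeff (I ! q) y) * coeff (I ! q) z) = (if y = z then 1 else 0)"
proof -
  note F = fourier_mat_carrier
  obtain i where i: "i < n" "g i = y" using ex_g[OF y] .
  obtain j where j: "j < n" "g j = z" using ex_g[OF z] .
  have "(\<Sum>q<length I. cnj (coeff (I ! q) y) * coeff (I ! q) z) = (mat_adjoint F * F) $$ (i, j)"
    unfolding index_mult_mat_sum[OF mat_adjoint_carrier[OF F] F i(1) j(1)]
    using i j F by (auto simp: index_fourier_mat intro!: sum.cong)
  also have "\<dots> = (if y = z then 1 else 0)"
    unfolding fourier_mat_adjoint_mult using i j g by (auto simp: bij_betw_def inj_on_def)
  finally show ?thesis .
qed

end

section \<open>The block diagonal factor and the factorization\<close>

locale enumerated_irreps_algebra = enumerated_irreps + complex_algebra scale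
  for scale :: "complex \<Rightarrow> 'c::{ring, monoid_mult} \<Rightarrow> 'c" +
  fixes a :: "'a \<Rightarrow> 'c"
begin

abbreviation "\<Lambda> \<equiv> Lambda_mat scale G a s d \<phi>"

text \<open>Within block \<open>k\<close> the quotient by \<open>d k\<close> selects the copy of the
  repeated small matrix, that is, one of the stacked columns, and the remainder selects the row in
  it.\<close>

lemma Lambda_mat_carrier: "\<Lambda> \<in> carrier_mat (length I) (length I)"
  and index_Lambda_mat: "q < length I \<Longrightarrow> r < length I \<Longrightarrow> I ! q = (k, p) \<Longrightarrow> I ! r = (l, p') \<Longrightarrow>
    \<Lambda> $$ (q, r) = (if k = l \<and> p div d k = p' div d k
      then lambda_mat scale G a (d k) (\<phi> k) $$ (p mod d k, p' mod d k) else 0)"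
proof -
  have lam: "lambda_mat scale G a (d k) (\<phi> k) \<in> carrier_mat (d k) (d k)" for k
    by (simp add: lambda_mat_def)
  have blk: "Lambda_block scale G a (d k) (\<phi> k) \<in> carrier_mat ((d k)\<^sup>2) ((d k)\<^sup>2)" for k
    using diag_block_mat_replicate(1)[OF lam] by (simp add: Lambda_block_def power2_eq_square)
  show "\<Lambda> \<in> carrier_mat (length I) (length I)"
    unfolding Lambda_mat_def by (rule diag_block_mat_block_index(1)[OF blk])
  assume qr: "q < length I" "r < length I" and kp: "I ! q = (k, p)" and lp: "I ! r = (l, p')"
  have "p < (d k)\<^sup>2" "p' < (d l)\<^sup>2"
    using nth_block_index[OF qr(1)] nth_block_index[OF qr(2)] kp lp by (metis prod.inject)+
  then show "\<Lambda> $$ (q, r) = (if k = l \<and> p div d k = p' div d k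
      then lambda_mat scale G a (d k) (\<phi> k) $$ (p mod d k, p' mod d k) else 0)"
    unfolding Lambda_mat_def diag_block_mat_block_index(2)[OF blk qr] kp lp
    by (auto simp: Lambda_block_def power2_eq_square diag_block_mat_replicate(2)[OF lam])
qed

text \<open>Multiplicativity of \<open>\<phi> k\<close>: for each \<open>x\<close> the sum over
  \<open>r\<close> forms an entry of \<open>\<phi> k x * \<phi> k y\<close>, hence of
  \<open>\<phi> k (x \<otimes> y)\<close>.\<close>

lemma lambda_mat_mult_coeff:
  assumes k: "k < s" and p: "p < (d k)\<^sup>2" and y: "y \<in> carrier G"
  shows "(\<Sum>r<d k. lambda_mat scale G a (d k) (\<phi> k) $$ (p mod d k, r) * scale (coeff (k, p div d k * d k + r) y) 1)
    = (\<Sum>x\<in>carrier G. a x * scale (coeff (k, p) (x \<otimes> y)) 1)"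
proof -
  let ?c = "complex_of_real (weight k)" and ?i = "p mod d k" and ?j = "p div d k"
  have b: "?i < d k" "?j < d k"
    using p degree_pos[OF k] by (auto simp: power2_eq_square less_mult_imp_div_less)
  have "(\<Sum>r<d k. lambda_mat scale G a (d k) (\<phi> k) $$ (?i, r) * scale (coeff (k, ?j * d k + r) y) 1)
    = (\<Sum>r<d k. \<Sum>x\<in>carrier G. scale (?c * (\<phi> k x $$ (?i, r) * \<phi> k y $$ (r, ?j))) (a x))"
  proof (rule sum.cong)
    fix r assume "r \<in> {..<d k}"
    then have r: "r < d k" by simp
    have "lambda_mat scale G a (d k) (\<phi> k) $$ (?i, r) = (\<Sum>x\<in>carrier G. scale (\<phi> k x $$ (?i, r)) (a x))"
      using b r by (auto simp: lambda_mat_def index_embed_mat[OF \<phi>_carrier[OF k]] mult_scale_one intro!: sum.cong)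
    moreover have "coeff (k, ?j * d k + r) y = ?c * \<phi> k y $$ (r, ?j)"
      using r by (simp add: coeff_def)
    ultimately show "lambda_mat scale G a (d k) (\<phi> k) $$ (?i, r) * scale (coeff (k, ?j * d k + r) y) 1
      = (\<Sum>x\<in>carrier G. scale (?c * (\<phi> k x $$ (?i, r) * \<phi> k y $$ (r, ?j))) (a x))"
      by (simp add: mult_scale_one scale_sum_right mult_ac)
  qed simp
  also have "\<dots> = (\<Sum>x\<in>carrier G. scale (?c * (\<Sum>r<d k. \<phi> k x $$ (?i, r) * \<phi> k y $$ (r, ?j))) (a x))"
    by (subst sum.swap) (simp add: scale_sum_left sum_distrib_left)
  also have "\<dots> = (\<Sum>x\<in>carrier G. a x * scale (coeff (k, p) (x \<otimes> y)) 1)"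
    using b by (auto simp: coeff_def mult_scale_one unitary_rep_mult[OF unitary_rep_\<phi>[OF k] _ y]
        index_mult_mat_sum[OF \<phi>_carrier[OF k] \<phi>_carrier[OF k y]] intro!: sum.cong)
  finally show ?thesis .
qed

text \<open>The two levels of block structure reduce the row sum to a single copy of the small
  matrix, where \<open>lambda_mat_mult_coeff\<close> applies.\<close>

lemma Lambda_mat_mult_fourier_mat:
  assumes q: "q < length I" and j: "j < n"
  shows "(\<Lambda> * embed_mat scale F) $$ (q, j) = (\<Sum>x\<in>carrier G. a x * scale (coeff (I ! q) (x \<otimes> g j)) 1)"
proof -
  note F = fourier_mat_carrier
  obtain k p where kp: "I ! q = (k, p)" "k < s" "p < (d k)\<^sup>2" using nth_block_index[OF q] by blast
  have dk: "d k > 0" by (rule degree_pos[OF kp(2)])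
  have pd: "p div d k < d k" using kp(3) by (simp add: power2_eq_square less_mult_imp_div_less)
  \<comment> \<open>The summand as a function of the row label, in the form that
    \<open>sum_block_index\<close> turns into a double sum.\<close>
  define h where "h = (\<lambda>(l, p'). if k = l \<and> p div d k = p' div d k
      then lambda_mat scale G a (d k) (\<phi> k) $$ (p mod d k, p' mod d k) * scale (coeff (l, p') (g j)) 1 else 0)"
  have "(\<Lambda> * embed_mat scale F) $$ (q, j) = (\<Sum>r<length I. h (I ! r))"
    unfolding index_mult_mat_sum[OF Lambda_mat_carrier embed_mat_carrier[OF F] q j]
  proof (rule sum.cong)
    fix r assume "r \<in> {..<length I}"
    then have r: "r < length I" by simp
    obtain l p' where lp: "I ! r = (l, p')" by fastforce
    show "\<Lambda> $$ (q, r) * embed_mat scale F $$ (r, j) = h (I ! r)"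
      unfolding index_Lambda_mat[OF q r kp(1) lp] index_embed_mat[OF F r j] index_fourier_mat[OF r j]
      by (auto simp: lp h_def)
  qed simp
  also have "\<dots> = (\<Sum>l<s. \<Sum>p'<(d l)\<^sup>2. h (l, p'))" by (rule sum_block_index)
  also have "\<dots> = (\<Sum>l<s. if l = k then \<Sum>p'<(d k)\<^sup>2. h (k, p') else 0)"
    by (intro sum.cong) (auto simp: h_def)
  also have "\<dots> = (\<Sum>p'<(d k)\<^sup>2. h (k, p'))" using kp(2) by simp
  \<comment> \<open>Only labels in the same copy as \<open>p\<close> contribute; they are
    \<open>p div d k * d k + r\<close> with \<open>r < d k\<close>.\<close>
  also have "\<dots> = (\<Sum>p' | p' < (d k)\<^sup>2 \<and> p div d k = p' div d k. h (k, p'))"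
    by (rule sum.mono_neutral_right) (auto simp: h_def)
  also have "\<dots> = (\<Sum>r<d k. lambda_mat scale G a (d k) (\<phi> k) $$ (p mod d k, r)
      * scale (coeff (k, p div d k * d k + r) (g j)) 1)"
  proof (rule sum.reindex_bij_witness[of _ "\<lambda>r. p div d k * d k + r" "\<lambda>p'. p' mod d k"])
    fix r assume "r \<in> {..<d k}"
    then have r: "r < d k" by simp
    have "p div d k * d k + r < Suc (p div d k) * d k" using r by simp
    also have "\<dots> \<le> d k * d k" using pd by (intro mult_right_mono) auto
    finally show "p div d k * d k + r \<in> {p'. p' < (d k)\<^sup>2 \<and> p div d k = p' div d k}"
      using r by (simp add: power2_eq_square)
    show "(p div d k * d k + r) mod d k = r" using r by simp
  next
    fix p' assume "p' \<in> {p'. p' < (d k)\<^sup>2 \<and> p div d k = p' div d k}"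
    then show "p div d k * d k + p' mod d k = p'" "p' mod d k \<in> {..<d k}"
      "lambda_mat scale G a (d k) (\<phi> k) $$ (p mod d k, p' mod d k)
        * scale (coeff (k, p div d k * d k + p' mod d k) (g j)) 1 = h (k, p')"
      using dk by (simp_all add: h_def)
  qed
  also have "\<dots> = (\<Sum>x\<in>carrier G. a x * scale (coeff (I ! q) (x \<otimes> g j)) 1)"
    unfolding kp(1) by (rule lambda_mat_mult_coeff[OF kp(2,3) g_closed[OF j]])
  finally show ?thesis .
qed

lemma group_mat_factorization:
  "group_mat G n g a = embed_mat scale (mat_adjoint F) * \<Lambda> * embed_mat scale F"
proof (rule eq_matI)
  note F = fourier_mat_carrier and Fa = mat_adjoint_carrier[OF fourier_mat_carrier]
  note EF = embed_mat_carrier[OF F] and EFa = embed_mat_carrier[OF Fa]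
  fix i j assume "i < dim_row (embed_mat scale (mat_adjoint F) * \<Lambda> * embed_mat scale F)"
    "j < dim_col (embed_mat scale (mat_adjoint F) * \<Lambda> * embed_mat scale F)"
  then have i: "i < n" and j: "j < n" using EF EFa by auto
  have M: "\<Lambda> * embed_mat scale F \<in> carrier_mat (length I) n"
    by (rule mult_carrier_mat[OF Lambda_mat_carrier EF])
  have "(embed_mat scale (mat_adjoint F) * \<Lambda> * embed_mat scale F) $$ (i, j) =
    (\<Sum>q<length I. \<Sum>x\<in>carrier G. scale (cnj (coeff (I ! q) (g i)) * coeff (I ! q) (x \<otimes> g j)) (a x))"
    unfolding assoc_mult_mat[OF EFa Lambda_mat_carrier EF] index_mult_mat_sum[OF EFa M i j]
  proof (rule sum.cong)
    fix q assume "q \<in> {..<length I}"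
    then have q: "q < length I" by simp
    have "mat_adjoint F $$ (i, q) = cnj (coeff (I ! q) (g i))"
      using i q F by (simp add: index_fourier_mat)
    then show "embed_mat scale (mat_adjoint F) $$ (i, q) * (\<Lambda> * embed_mat scale F) $$ (q, j) =
      (\<Sum>x\<in>carrier G. scale (cnj (coeff (I ! q) (g i)) * coeff (I ! q) (x \<otimes> g j)) (a x))"
      by (simp add: index_embed_mat[OF Fa i q] Lambda_mat_mult_fourier_mat[OF q j]
          scale_one_mult mult_scale_one scale_sum_right)
  qed simp
  \<comment> \<open>After exchanging the sums, the scalar in front of \<open>a x\<close> is the
    inner product of the columns of \<open>F\<close> belonging to \<open>g i\<close> and
    \<open>x \<otimes> g j\<close>.\<close>
  also have "\<dots> = (\<Sum>x\<in>carrier G. scale (\<Sum>q<length I. cnj (coeff (I ! q) (g i)) * coeff (I ! q) (x \<otimes> g j)) (a x))"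
    by (subst sum.swap) (simp add: scale_sum_left)
  also have "\<dots> = (\<Sum>x\<in>carrier G. if x = g i \<otimes> inv g j then a x else 0)"
  proof (rule sum.cong)
    fix x assume x: "x \<in> carrier G"
    have "g i = x \<otimes> g j \<longleftrightarrow> x = g i \<otimes> inv g j"
      using x g_closed[OF i] g_closed[OF j] inv_solve_right by metis
    then show "scale (\<Sum>q<length I. cnj (coeff (I ! q) (g i)) * coeff (I ! q) (x \<otimes> g j)) (a x)
      = (if x = g i \<otimes> inv g j then a x else 0)"
      using x g_closed[OF i] g_closed[OF j] by (simp add: coeff_columns_orthonormal)
  qed simp
  also have "\<dots> = a (g i \<otimes> inv g j)"
    using fin g_closed[OF i] g_closed[OF j] by simp
  finally show "group_mat G n g a $$ (i, j) =
    (embed_mat scale (mat_adjoint F) * \<Lambda> * embed_mat scale F) $$ (i, j)"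
    using i j by (simp add: group_mat_def)
qed (use fourier_mat_carrier in \<open>simp_all add: group_mat_def embed_mat_def\<close>)

end

theorem theorem2p1:
  fixes G :: "('g, 'm) monoid_scheme"
    and n :: nat
    and g :: "nat \<Rightarrow> 'g"
    and scale :: "complex \<Rightarrow> 'a::{ring, monoid_mult} \<Rightarrow> 'a"
    and s :: nat
    and d :: "nat \<Rightarrow> nat"
    and \<Phi> \<phi> :: "nat \<Rightarrow> 'g \<Rightarrow> complex mat"
    and b :: "nat \<Rightarrow> nat \<Rightarrow> complex vec"
    and \<F> :: "complex mat"
    and a :: "'g \<Rightarrow> 'a"
  assumes "group G" and "finite (carrier G)" and "n = Coset.order G"
    and "bij_betw g {..<n} (carrier G)" and "g 0 = \<one>\<^bsub>G\<^esub>"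
    and "complex_algebra scale"
    and "complete_irreps G s d \<Phi>"
    and "\<And>k. k < s \<Longrightarrow> orthonormal_basis (d k) (b k)"
    and "\<And>k x. k < s \<Longrightarrow> x \<in> carrier G \<Longrightarrow> \<phi> k x = basis_mat (d k) (b k) (\<Phi> k x)"
    and "\<F> = fourier_mat n g s d \<phi>"
  shows "unitary_mat n \<F> \<and>
    group_mat G n g a =
      embed_mat scale (mat_adjoint \<F>) * Lambda_mat scale G a s d \<phi> * embed_mat scale \<F>"
proof -
  interpret group G by fact
  interpret complex_algebra scale by fact
  interpret enumerated_irreps_algebra G s d \<Phi> \<phi> b n g scale a
    by unfold_locales fact+
  show ?thesis
    unfolding \<open>\<F> = fourier_mat n g s d \<phi>\<close>
    using unitary_fourier_mat group_mat_factorization by (rule conjI)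
qed

end
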